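(* Let $F$ be an algebraically closed field with $\operatorname{char}(F)=0$, let $A=M_n(F)$ with $n\ge 2$, and let $f\in F\langle \mathcal X\rangle$ be a polynomial which is not cyclically equivalent to an identity of $A$ and is not a central polynomial of $A$. Then every matrix in $A$ is a linear combination (with coefficients in $F$) of nine matrices from $f(A)$.
   Context: $F\langle \mathcal X\rangle$ is the free (unital, associative) algebra over $F$ on $\mathcal X=\{X_1,X_2,\dots\}$, i.e. the algebra of noncommutative polynomials. For $f=f(X_1,\dots,X_m)$, $f(A)=\{f(a_1,\dots,a_m)\mid a_1,\dots,a_m\in A\}$. $f$ is an identity of $A$ if $f(A)=\{0\}$; $f$ is a central polynomial of $A$ if $f(A)$ is contained in the center of $A$ but $f$ is not an identity of $A$ (a nonzero constant term is allowed). Polynomials $f,g\in F\langle\mathcal X\rangle$ are cyclically equivalent if $f-g$ is a sum of commutators $[p,q]=pq-qp$ with $p,q\in F\langle\mathcal X\rangle$. *)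

theory Defs
  imports "HOL-Analysis.Analysis" "HOL-Library.Poly_Mapping"
begin

text \<open>
  The free monoid on \<open>X\<^sub>1, X\<^sub>2, \<dots>\<close>, written additively because the convolution product of
  \<^theory>\<open>HOL-Library.Poly_Mapping\<close> expects an additive monoid of exponents. The letter \<open>i\<close> stands
  for \<open>X\<^sub>i\<^sub>+\<^sub>1\<close>.
\<close>

datatype nc_word = Word (letters: "nat list")

instantiation nc_word :: monoid_add
begin

definition zero_nc_word :: nc_word where
  "0 = Word []"

definition plus_nc_word :: "nc_word \<Rightarrow> nc_word \<Rightarrow> nc_word" where
  "u + v = Word (letters u @ letters v)"

instance
  by standard (simp_all add: zero_nc_word_def plus_nc_word_def)

end

text \<open>
  The free unital associative algebra is the monoid algebra of the free monoid; its ring structure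
  (convolution) is the one of \<^theory>\<open>HOL-Library.Poly_Mapping\<close>.
\<close>

type_synonym 'a ncpoly = "nc_word \<Rightarrow>\<^sub>0 'a"

definition smult_matrix :: "'a::times \<Rightarrow> 'a^'n^'m \<Rightarrow> 'a^'n^'m" where
  "smult_matrix c M = (\<chi> i j. c * M $ i $ j)"

text \<open>
  The multiplication of the type class \<^class>\<open>times\<close> is entrywise on \<^typ>\<open>'a^'n^'n\<close>, so words are
  evaluated with the matrix product \<open>**\<close> and the identity matrix \<open>mat 1\<close>.
\<close>

definition eval_word :: "(nat \<Rightarrow> 'a::semiring_1^'n^'n) \<Rightarrow> nc_word \<Rightarrow> 'a^'n^'n" where
  "eval_word a w = foldr (\<lambda>i M. a i ** M) (letters w) (mat 1)"

definition eval_ncpoly :: "(nat \<Rightarrow> 'a::semiring_1^'n^'n) \<Rightarrow> 'a ncpoly \<Rightarrow> 'a^'n^'n" where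
  "eval_ncpoly a f =
     (\<Sum>w\<in>Poly_Mapping.keys f. smult_matrix (Poly_Mapping.lookup f w) (eval_word a w))"

text \<open>
  The image \<open>f(A)\<close> for \<open>A = M\<^sub>n(F)\<close>. All variables are assigned a matrix; only the finitely many
  occurring in \<open>f\<close> matter.
\<close>

definition nc_image :: "'a::semiring_1 ncpoly \<Rightarrow> ('a^'n^'n) set" where
  "nc_image f = range (\<lambda>a. eval_ncpoly a f)"

definition matrix_center :: "('a::semiring_1^'n^'n) set" where
  "matrix_center = {Z. \<forall>M. Z ** M = M ** Z}"

definition matrix_identity :: "'n::finite itself \<Rightarrow> 'a::semiring_1 ncpoly \<Rightarrow> bool" where
  "matrix_identity _ f \<longleftrightarrow> nc_image f = {0 :: 'a^'n^'n}"

definition matrix_central_poly :: "'n::finite itself \<Rightarrow> 'a::semiring_1 ncpoly \<Rightarrow> bool" where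
  "matrix_central_poly N f \<longleftrightarrow>
     nc_image f \<subseteq> (matrix_center :: ('a^'n^'n) set) \<and> \<not> matrix_identity N f"

definition cyclically_equivalent :: "'a::ring_1 ncpoly \<Rightarrow> 'a ncpoly \<Rightarrow> bool" where
  "cyclically_equivalent f g \<longleftrightarrow> (\<exists>pqs. f - g = (\<Sum>(p, q)\<leftarrow>pqs. p * q - q * p))"

end

theory Submission
  imports Defs
begin

text \<open>
  Trace zero matrices. Evaluate \<open>f\<close> on matrices of a quantum torus, spanned by the monomials
  \<open>\<alpha>\<^sup>k \<beta>\<^sup>l X k l\<close> in rescaled clock and shift matrices. For a suitable one-parameter specialization
  the noncentral part of the value is asymptotically a single noncentral monomial, which is far from
  scalar. Hence some \<open>b\<close> in the conjugation invariant set \<open>f(A)\<close> satisfies \<open>b e\<^sub>a = s e\<^sub>a + t e\<^bsub>\<sigma> a\<^esub>\<close>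
  with \<open>t \<noteq> 0\<close> for at least a third of the basis vectors. If \<open>x\<^sup>2 = 0\<close> then
  \<open>2 [x, b] = (1 + x) b (1 - x) - (1 - x) b (1 + x)\<close>, and the sum of two such commutators can be made
  similar to a diagonal matrix \<open>D\<close> with distinct entries. A trace zero matrix is similar to one
  with zero diagonal \<open>U + L\<close> (\<open>U\<close> strictly upper, \<open>L\<close> strictly lower triangular), which equals
  \<open>(D + U) - (D - L)\<close>, and both \<open>D + U\<close> and \<open>D - L\<close> are similar to \<open>D\<close>. This uses eight values.

  The ninth value is one with nonzero trace: if all values of \<open>f\<close> have trace zero, then each
  homogeneous component of \<open>f\<close> is cyclically equivalent to the average of the cyclic rotations of
  its words, and this average is an identity.
\<close>

section \<open>Matrices\<close>

lemma smult_matrix_nth [simp]: "smult_matrix c M $ i $ j = c * M $ i $ j"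
  by (simp add: smult_matrix_def)

lemma smult_matrix_mult_left:
  fixes A :: "'a::comm_semiring_1^'n^'m"
  shows "smult_matrix c A ** B = smult_matrix c (A ** B)"
  by (simp add: vec_eq_iff matrix_matrix_mult_def sum_distrib_left mult.assoc)

lemma smult_matrix_mult_right:
  fixes A :: "'a::comm_semiring_1^'n^'m"
  shows "A ** smult_matrix c B = smult_matrix c (A ** B)"
  by (simp add: vec_eq_iff matrix_matrix_mult_def sum_distrib_left mult.left_commute)

lemma smult_matrix_smult_matrix [simp]:
  fixes A :: "'a::comm_semiring_1^'n^'m"
  shows "smult_matrix c (smult_matrix d A) = smult_matrix (c * d) A"
  by (simp add: vec_eq_iff mult.assoc)

lemma smult_matrix_1 [simp]: "smult_matrix 1 (A :: 'a::comm_semiring_1^'n^'m) = A"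
  by (simp add: vec_eq_iff)

lemma smult_matrix_0 [simp]: "smult_matrix 0 (A :: 'a::comm_semiring_1^'n^'m) = 0"
  by (simp add: vec_eq_iff)

lemma smult_matrix_0_right [simp]: "smult_matrix c (0 :: 'a::comm_semiring_1^'n^'m) = 0"
  by (simp add: vec_eq_iff)

lemma smult_matrix_add: "smult_matrix c (A + B :: 'a::comm_semiring_1^'n^'m) = smult_matrix c A + smult_matrix c B"
  by (simp add: vec_eq_iff distrib_left)

lemma smult_matrix_add_left:
  "smult_matrix (c + d) (A :: 'a::comm_semiring_1^'n^'m) = smult_matrix c A + smult_matrix d A"
  by (simp add: vec_eq_iff distrib_right)

lemma smult_matrix_sum:
  "smult_matrix c (\<Sum>i\<in>I. A i :: 'a::comm_semiring_1^'n^'m) = (\<Sum>i\<in>I. smult_matrix c (A i))"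
  by (simp add: vec_eq_iff sum_distrib_left)

lemma matrix_mult_zero [simp]:
  "(0 :: 'a::semiring_1^'n^'m) ** A = 0" "B ** (0 :: 'a::semiring_1^'n^'m) = 0"
  by (simp_all add: vec_eq_iff matrix_matrix_mult_def)

lemma matrix_mult_add_left: "(A + B :: 'a::semiring_1^'n^'m) ** C = A ** C + B ** C"
  by (simp add: vec_eq_iff matrix_matrix_mult_def distrib_right sum.distrib)

lemma matrix_mult_sum_left:
  fixes A :: "_ \<Rightarrow> 'a::comm_semiring_1^'n^'m"
  shows "(\<Sum>i\<in>I. A i) ** B = (\<Sum>i\<in>I. A i ** B)"
  by (induction I rule: infinite_finite_induct) (simp_all add: matrix_mult_add_left)

lemma matrix_mult_sum_right:
  fixes A :: "_ \<Rightarrow> 'a::comm_semiring_1^'n^'m"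
  shows "B ** (\<Sum>i\<in>I. A i) = (\<Sum>i\<in>I. B ** A i)"
  by (induction I rule: infinite_finite_induct) (simp_all add: matrix_add_ldistrib)

lemma matrix_mult_diff_left: "(A - B :: 'a::comm_ring_1^'n^'m) ** C = A ** C - B ** C"
  by (simp add: vec_eq_iff matrix_matrix_mult_def left_diff_distrib sum_subtractf)

lemma matrix_mult_diff_right: "C ** (A - B :: 'a::comm_ring_1^'n^'m) = C ** A - C ** B"
  by (simp add: vec_eq_iff matrix_matrix_mult_def right_diff_distrib sum_subtractf)

lemma trace_smult: "trace (smult_matrix c A) = c * trace (A :: 'a::comm_semiring_1^'n^'n)"
  by (simp add: trace_def sum_distrib_left)

lemma trace_sum: "trace (\<Sum>i\<in>I. A i :: 'a::comm_semiring_1^'n^'n) = (\<Sum>i\<in>I. trace (A i))"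
  unfolding trace_def by (subst sum.swap) simp

text \<open>Nondegeneracy of the trace form: the matrix unit with its 1 in row \<open>j\<close>,
  column \<open>i\<close> reads off the entry \<open>A $ i $ j\<close>.\<close>

lemma trace_mult_eq_0_imp_eq_0:
  fixes A :: "'a::comm_semiring_1^'n^'n"
  assumes "\<And>Z. trace (A ** Z) = 0"
  shows "A = 0"
proof -
  have "A $ i $ j = 0" for i j
  proof -
    have *: "(A ** (\<chi> p q. if p = j \<and> q = i then 1 else 0)) $ p $ q = (if q = i then A $ p $ j else 0)" for p q
      by (simp add: matrix_matrix_mult_def if_distrib cong: if_cong)
    have "trace (A ** (\<chi> p q. if p = j \<and> q = i then 1 else 0)) = A $ i $ j"
      by (simp add: trace_def *)
    with assms show ?thesis by metis
  qed
  thus ?thesis by (simp add: vec_eq_iff)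
qed

section \<open>Similarity of matrices\<close>

definition similar_matrix :: "'a::comm_ring_1^'n^'n \<Rightarrow> 'a^'n^'n \<Rightarrow> bool" where
  "similar_matrix A B \<longleftrightarrow> (\<exists>P Q. P ** Q = mat 1 \<and> Q ** P = mat 1 \<and> A = P ** B ** Q)"

lemma similar_matrix_sym:
  assumes "similar_matrix A B"
  shows "similar_matrix B A"
proof -
  from assms obtain P Q where PQ: "P ** Q = mat 1" "Q ** P = mat 1" "A = P ** B ** Q"
    unfolding similar_matrix_def by blast
  have "Q ** A ** P = (Q ** P) ** B ** (Q ** P)"
    by (simp add: PQ(3) matrix_mul_assoc)
  hence "B = Q ** A ** P" by (simp add: PQ)
  with PQ show ?thesis unfolding similar_matrix_def by blast
qed

lemma similar_matrix_trans:
  assumes "similar_matrix A B" "similar_matrix B C"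
  shows "similar_matrix A C"
proof -
  from assms obtain P Q P' Q' where PQ: "P ** Q = mat 1" "Q ** P = mat 1" "A = P ** B ** Q"
    "P' ** Q' = mat 1" "Q' ** P' = mat 1" "B = P' ** C ** Q'"
    unfolding similar_matrix_def by blast
  have "(P ** P') ** (Q' ** Q) = P ** (P' ** Q') ** Q" "(Q' ** Q) ** (P ** P') = Q' ** (Q ** P) ** P'"
    "A = (P ** P') ** C ** (Q' ** Q)"
    by (simp_all add: PQ(3,6) matrix_mul_assoc)
  with PQ show ?thesis unfolding similar_matrix_def by (metis matrix_mul_rid)
qed

lemma similar_matrix_refl: "similar_matrix A A"
  unfolding similar_matrix_def by (intro exI[of _ "mat 1"]) simp

lemma trace_similar_matrix:
  assumes "similar_matrix A B"
  shows "trace A = trace B"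
proof -
  from assms obtain P Q where PQ: "P ** Q = mat 1" "Q ** P = mat 1" "A = P ** B ** Q"
    unfolding similar_matrix_def by blast
  have "trace (P ** B ** Q) = trace (Q ** (P ** B))" by (rule trace_mul_sym)
  also have "Q ** (P ** B) = B" by (simp add: matrix_mul_assoc PQ)
  finally show ?thesis by (simp add: PQ)
qed

text \<open>A square matrix with trivial kernel has a two-sided inverse, so an injective intertwiner
  \<open>P\<close> is enough.\<close>

lemma similar_matrixI:
  fixes A B :: "'a::field^'n^'n"
  assumes "\<And>x. P *v x = 0 \<Longrightarrow> x = 0" and "A ** P = P ** B"
  shows "similar_matrix A B"
proof -
  have "\<exists>Q. Q ** P = mat 1"
    using assms(1) by (subst matrix_left_invertible_ker) blast
  then obtain Q where Q: "Q ** P = mat 1" by blast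
  hence Q': "P ** Q = mat 1" by (simp add: matrix_left_right_inverse)
  have "A = A ** (P ** Q)" by (simp add: Q')
  also have "\<dots> = P ** B ** Q" by (simp add: matrix_mul_assoc assms)
  finally show ?thesis unfolding similar_matrix_def using Q Q' by blast
qed

section \<open>Evaluation\<close>

lemma eval_word_Nil [simp]: "eval_word a (Word []) = mat 1"
  by (simp add: eval_word_def)

lemma eval_word_Cons [simp]: "eval_word a (Word (i # w)) = a i ** eval_word a (Word w)"
  by (simp add: eval_word_def)

lemma eval_word_append: "eval_word a (Word (u @ v)) = eval_word a (Word u) ** eval_word a (Word v)"
  by (induction u) (simp_all add: matrix_mul_assoc)

lemma eval_ncpoly_superset:
  assumes "finite S" "Poly_Mapping.keys f \<subseteq> S"
  shows "eval_ncpoly a f = (\<Sum>w\<in>S. smult_matrix (Poly_Mapping.lookup f w) (eval_word a w))"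
  unfolding eval_ncpoly_def using assms
  by (intro sum.mono_neutral_left) (auto simp: in_keys_iff vec_eq_iff)

lemma eval_ncpoly_0 [simp]: "eval_ncpoly a 0 = 0"
  by (simp add: eval_ncpoly_def)

lemma eval_ncpoly_single [simp]:
  "eval_ncpoly a (Poly_Mapping.single w c) = smult_matrix c (eval_word a w)"
  by (subst eval_ncpoly_superset[of "{w}"]) auto

lemma eval_ncpoly_add:
  fixes f :: "'a::comm_semiring_1 ncpoly"
  shows "eval_ncpoly a (f + g) = eval_ncpoly a f + eval_ncpoly a g"
proof -
  let ?S = "Poly_Mapping.keys f \<union> Poly_Mapping.keys g"
  have "eval_ncpoly a (f + g) = (\<Sum>w\<in>?S. smult_matrix (Poly_Mapping.lookup (f + g) w) (eval_word a w))"
    by (intro eval_ncpoly_superset) (use Poly_Mapping.keys_add[of f g] in auto)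
  also have "\<dots> = (\<Sum>w\<in>?S. smult_matrix (Poly_Mapping.lookup f w) (eval_word a w)) +
      (\<Sum>w\<in>?S. smult_matrix (Poly_Mapping.lookup g w) (eval_word a w))"
    by (simp add: lookup_add smult_matrix_add_left sum.distrib)
  finally show ?thesis
    by (simp add: eval_ncpoly_superset[of ?S f] eval_ncpoly_superset[of ?S g])
qed

lemma eval_ncpoly_sum:
  fixes f :: "_ \<Rightarrow> 'a::comm_semiring_1 ncpoly"
  shows "eval_ncpoly a (\<Sum>i\<in>I. f i) = (\<Sum>i\<in>I. eval_ncpoly a (f i))"
  by (induction I rule: infinite_finite_induct) (simp_all add: eval_ncpoly_add)

lemma eval_word_conj:
  fixes a :: "nat \<Rightarrow> 'a::comm_ring_1^'n^'n"
  assumes "P ** Q = mat 1" "Q ** P = mat 1"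
  shows "eval_word (\<lambda>i. P ** a i ** Q) w = P ** eval_word a w ** Q"
proof -
  have "eval_word (\<lambda>i. P ** a i ** Q) (Word u) = P ** eval_word a (Word u) ** Q" for u
  proof (induction u)
    case (Cons i u)
    have "P ** a i ** Q ** (P ** eval_word a (Word u) ** Q)
        = P ** a i ** (Q ** P) ** eval_word a (Word u) ** Q"
      by (simp add: matrix_mul_assoc)
    with Cons show ?case by (simp add: assms matrix_mul_assoc)
  qed (simp add: assms)
  from this[of "letters w"] show ?thesis by simp
qed

text \<open>Conjugation is an algebra automorphism: conjugating a value amounts to conjugating the
  matrices substituted for the variables.\<close>

lemma nc_image_similar:
  assumes "B \<in> nc_image f" "similar_matrix A B"
  shows "A \<in> nc_image f"
proof -
  from assms obtain P Q a where PQ: "P ** Q = mat 1" "Q ** P = mat 1" "A = P ** B ** Q"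
    "B = eval_ncpoly a f"
    unfolding similar_matrix_def nc_image_def by blast
  have "A = eval_ncpoly (\<lambda>i. P ** a i ** Q) f"
    by (simp add: PQ(3,4) eval_ncpoly_def eval_word_conj[OF PQ(1,2)] matrix_mult_sum_left matrix_mult_sum_right
        smult_matrix_mult_left smult_matrix_mult_right)
  thus ?thesis by (simp add: nc_image_def)
qed

section \<open>Linear combinations of a bounded number of matrices\<close>

text \<open>Repetitions and zero coefficients are allowed, so \<open>k\<close> is an upper bound on
  the number of matrices used, and these bounds add up under sums.\<close>

definition lincombs :: "nat \<Rightarrow> ('a::comm_ring_1^'n^'n) set \<Rightarrow> ('a^'n^'n) set" where
  "lincombs k S = {\<Sum>i<k. smult_matrix (c i) (B i) |c B. \<forall>i<k. B i \<in> S}"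

lemma lincombsI:
  assumes "A = (\<Sum>i<k. smult_matrix (c i) (B i))" "\<forall>i<k. B i \<in> S"
  shows "A \<in> lincombs k S"
  unfolding lincombs_def by (rule CollectI, rule exI[of _ c], rule exI[of _ B], rule conjI, fact+)

lemma lincombs_1: "A \<in> S \<Longrightarrow> smult_matrix c A \<in> lincombs 1 S"
  unfolding lincombs_def by (intro CollectI exI[of _ "\<lambda>_. c"] exI[of _ "\<lambda>_. A"]) simp

lemma lincombs_add:
  assumes "A \<in> lincombs k S" "B \<in> lincombs l S"
  shows "A + B \<in> lincombs (k + l) S"
proof -
  from assms obtain c C d D where *: "A = (\<Sum>i<k. smult_matrix (c i) (C i))" "\<forall>i<k. C i \<in> S"
    "B = (\<Sum>i<l. smult_matrix (d i) (D i))" "\<forall>i<l. D i \<in> S"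
    unfolding lincombs_def by blast
  let ?c = "\<lambda>i. if i < k then c i else d (i - k)" and ?C = "\<lambda>i. if i < k then C i else D (i - k)"
  have split: "(\<Sum>i<k+l. g i) = (\<Sum>i<k. g i) + (\<Sum>i<l. g (k + i))" for g :: "nat \<Rightarrow> 'a^'n^'n"
    by (induction l) (simp_all add: add.assoc)
  have "(\<Sum>i<k+l. smult_matrix (?c i) (?C i)) = A + B"
    unfolding split *(1,3) by (intro arg_cong2[of _ _ _ _ "(+)"] sum.cong) simp_all
  hence "A + B = (\<Sum>i<k+l. smult_matrix (?c i) (?C i))" ..
  moreover have "\<forall>i<k+l. ?C i \<in> S" using * by auto
  ultimately show ?thesis by (rule lincombsI)
qed

lemma lincombs_smult:
  assumes "A \<in> lincombs k S"
  shows "smult_matrix t A \<in> lincombs k S"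
proof -
  from assms obtain c C where *: "A = (\<Sum>i<k. smult_matrix (c i) (C i))" "\<forall>i<k. C i \<in> S"
    unfolding lincombs_def by blast
  have "smult_matrix t A = (\<Sum>i<k. smult_matrix (t * c i) (C i))"
    by (simp add: * smult_matrix_sum)
  thus ?thesis using *(2) by (rule lincombsI)
qed

lemma lincombs_diff:
  assumes "A \<in> lincombs k S" "B \<in> lincombs l S"
  shows "A - B \<in> lincombs (k + l) S"
proof -
  have "A + smult_matrix (-1) B \<in> lincombs (k + l) S"
    by (intro lincombs_add lincombs_smult assms)
  also have "A + smult_matrix (-1) B = A - B" by (simp add: vec_eq_iff)
  finally show ?thesis .
qed

lemma lincombs_similar:
  assumes "A \<in> lincombs k S" "similar_matrix B A"
    and closed: "\<And>A B. A \<in> S \<Longrightarrow> similar_matrix B A \<Longrightarrow> B \<in> S"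
  shows "B \<in> lincombs k S"
proof -
  from assms obtain c C where *: "A = (\<Sum>i<k. smult_matrix (c i) (C i))" "\<forall>i<k. C i \<in> S"
    unfolding lincombs_def by blast
  from assms obtain P Q where PQ: "P ** Q = mat 1" "Q ** P = mat 1" "B = P ** A ** Q"
    unfolding similar_matrix_def by blast
  have "B = (\<Sum>i<k. smult_matrix (c i) (P ** C i ** Q))"
    by (simp add: PQ(3) *(1) matrix_mult_sum_left matrix_mult_sum_right
        smult_matrix_mult_left smult_matrix_mult_right)
  moreover have "\<forall>i<k. P ** C i ** Q \<in> S"
  proof (intro allI impI)
    fix i assume "i < k"
    with *(2) have "C i \<in> S" by simp
    thus "P ** C i ** Q \<in> S"
      by (rule closed) (use PQ(1,2) in \<open>unfold similar_matrix_def, blast\<close>)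
  qed
  ultimately show ?thesis by (rule lincombsI)
qed

section \<open>Diagonalization of triangular matrices and zero diagonals\<close>

definition diag_matrix :: "('n \<Rightarrow> 'a::zero) \<Rightarrow> 'a^'n^'n" where
  "diag_matrix h = (\<chi> p q. if p = q then h p else 0)"

text \<open>Back substitution along \<open>\<psi>\<close>: the entries of \<open>v\<close> before
  position \<open>q\<close> are found one at a time. The pivots \<open>h q - h r\<close> are nonzero
  because the diagonal entries are distinct.\<close>

lemma triangular_eigenvector:
  fixes M :: "'a::field^'n::finite^'n" and \<psi> :: "'n \<Rightarrow> nat"
  assumes \<psi>: "inj \<psi>" and upper: "\<And>p q. M $ p $ q \<noteq> 0 \<Longrightarrow> \<psi> p \<le> \<psi> q"
    and diag: "\<And>p. M $ p $ p = h p" and h: "inj h"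
  shows "\<exists>v. v $ q = 1 \<and> (\<forall>p. \<psi> q < \<psi> p \<longrightarrow> v $ p = 0) \<and> (\<forall>p. (M *v v) $ p = h q * v $ p)"
proof -
  \<comment> \<open>Induction on the depth \<open>m\<close>: the eigenvector equation holds in all
    rows at most \<open>m\<close> levels before \<open>q\<close>, stated additively to avoid
    truncated subtraction.\<close>
  have "\<exists>v. v $ q = 1 \<and> (\<forall>p. \<psi> q < \<psi> p \<longrightarrow> v $ p = 0) \<and>
          (\<forall>p. \<psi> q \<le> \<psi> p + m \<longrightarrow> (M *v v) $ p = h q * v $ p)" for m
  proof (induction m)
    case 0
    have "(M *v axis q 1) $ p = h q * axis q 1 $ p" if "\<psi> q \<le> \<psi> p" for p
    proof -
      have "(M *v axis q 1) $ p = M $ p $ q"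
        by (simp add: matrix_vector_mult_def axis_def if_distrib cong: if_cong)
      moreover have "M $ p $ q = 0" if "p \<noteq> q"
        using upper[of p q] \<open>\<psi> q \<le> \<psi> p\<close> that \<psi> by (metis injD order_antisym)
      ultimately show ?thesis using diag by (cases "p = q") (auto simp: axis_def)
    qed
    moreover have "axis q (1::'a) $ p = 0" if "\<psi> q < \<psi> p" for p
      using that by (auto simp: axis_def)
    ultimately show ?case by (intro exI[of _ "axis q 1"]) auto
  next
    case (Suc m)
    then obtain v where v: "v $ q = 1" "\<And>p. \<psi> q < \<psi> p \<Longrightarrow> v $ p = 0"
      "\<And>p. \<psi> q \<le> \<psi> p + m \<Longrightarrow> (M *v v) $ p = h q * v $ p" by blast
    show ?case
    proof (cases "\<exists>r. \<psi> q = \<psi> r + Suc m")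
      case False
      hence "\<psi> q \<le> \<psi> p + m" if "\<psi> q \<le> \<psi> p + Suc m" for p
        using that by (metis add_Suc_right le_Suc_eq)
      with v show ?thesis by blast
    next
      case True
      then obtain r where r: "\<psi> q = \<psi> r + Suc m" by blast
      hence "r \<noteq> q" by auto
      hence hqr: "h q - h r \<noteq> 0" using h by (auto dest: injD)
      \<comment> \<open>Row \<open>r\<close> of the eigenvector equation, solved for the entry at
        \<open>r\<close>. Later rows do not see the new entry because column \<open>r\<close> of
        \<open>M\<close> vanishes there.\<close>
      define c where "c = (\<Sum>s\<in>UNIV-{r}. M $ r $ s * v $ s) / (h q - h r)"
      define v' where "v' = (\<chi> p. if p = r then c else v $ p)"
      have mult: "(M *v v') $ p = M $ p $ r * c + (\<Sum>s\<in>UNIV-{r}. M $ p $ s * v $ s)" for p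
        unfolding matrix_vector_mult_def
        by (simp add: sum.remove[of UNIV r] v'_def)
      have mult0: "(M *v v) $ p = M $ p $ r * v $ r + (\<Sum>s\<in>UNIV-{r}. M $ p $ s * v $ s)" for p
        unfolding matrix_vector_mult_def
        by (simp add: sum.remove[of UNIV r])
      have "(M *v v') $ p = h q * v' $ p" if p: "\<psi> q \<le> \<psi> p + Suc m" for p
      proof (cases "p = r")
        case True
        have "(\<Sum>s\<in>UNIV-{r}. M $ r $ s * v $ s) = c * (h q - h r)"
          using hqr by (simp add: c_def)
        hence "(M *v v') $ r = h q * c"
          unfolding mult diag by (simp add: algebra_simps)
        with True show ?thesis by (simp add: v'_def)
      next
        case False
        hence "\<psi> p \<noteq> \<psi> r" using \<psi> by (auto dest: injD)
        with p r have p': "\<psi> q \<le> \<psi> p + m" "\<psi> r < \<psi> p" by auto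
        hence "M $ p $ r = 0" using upper[of p r] by fastforce
        with v(3)[OF p'(1)] False show ?thesis unfolding mult mult0 by (simp add: v'_def)
      qed
      moreover have "v' $ q = 1" using \<open>r \<noteq> q\<close> v by (simp add: v'_def)
      moreover have "v' $ p = 0" if "\<psi> q < \<psi> p" for p
        using that r v(2)[of p] by (auto simp: v'_def)
      ultimately show ?thesis by blast
    qed
  qed
  from this[of "\<psi> q"] show ?thesis by simp
qed

text \<open>The eigenvectors found above are the columns of \<open>P\<close>, which is unitriangular
  and hence injective.\<close>

lemma triangular_similar_diag_matrix:
  fixes M :: "'a::field^'n::finite^'n" and \<psi> :: "'n \<Rightarrow> nat"
  assumes \<psi>: "inj \<psi>" and upper: "\<And>p q. M $ p $ q \<noteq> 0 \<Longrightarrow> \<psi> p \<le> \<psi> q"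
    and diag: "\<And>p. M $ p $ p = h p" and h: "inj h"
  shows "similar_matrix M (diag_matrix h)"
proof -
  from triangular_eigenvector[OF assms] obtain V
    where V: "\<And>q. V q $ q = 1" "\<And>p q. \<psi> q < \<psi> p \<Longrightarrow> V q $ p = 0"
      "\<And>p q. (M *v V q) $ p = h q * V q $ p" by metis
  define P where "P = (\<chi> p q. V q $ p)"
  show ?thesis
  proof (rule similar_matrixI)
    have "(M ** P) $ p $ q = (P ** diag_matrix h) $ p $ q" for p q
    proof -
      have "(M ** P) $ p $ q = (M *v V q) $ p"
        by (simp add: matrix_matrix_mult_def matrix_vector_mult_def P_def)
      also have "\<dots> = (P ** diag_matrix h) $ p $ q"
        unfolding V(3) by (simp add: matrix_matrix_mult_def diag_matrix_def P_def if_distrib cong: if_cong)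
      finally show ?thesis .
    qed
    thus "M ** P = P ** diag_matrix h" by (simp add: vec_eq_iff)
  next
    fix x assume x: "P *v x = 0"
    show "x = 0"
    proof (rule ccontr)
      assume "x \<noteq> 0"
      hence ne: "{p. x $ p \<noteq> 0} \<noteq> {}" by (auto simp: vec_eq_iff)
      \<comment> \<open>The last nonzero coordinate of \<open>x\<close> in the order
        \<open>\<psi>\<close> is left unchanged by the unitriangular \<open>P\<close>.\<close>
      obtain q where q: "x $ q \<noteq> 0" "\<And>p. x $ p \<noteq> 0 \<Longrightarrow> \<psi> p \<le> \<psi> q"
      proof -
        have "Max (\<psi> ` {p. x $ p \<noteq> 0}) \<in> \<psi> ` {p. x $ p \<noteq> 0}"
          by (rule Max_in) (use ne in auto)
        then obtain q where "x $ q \<noteq> 0" "\<psi> q = Max (\<psi> ` {p. x $ p \<noteq> 0})" by auto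
        moreover from this(2) have "\<psi> p \<le> \<psi> q" if "x $ p \<noteq> 0" for p
          using that by simp
        ultimately show ?thesis using that by blast
      qed
      have "V s $ q * x $ s = (if s = q then x $ q else 0)" for s
      proof (cases "s = q \<or> x $ s = 0")
        case False
        with q(2)[of s] \<psi> have "\<psi> s < \<psi> q" by (metis injD order_le_less)
        with V(2) False show ?thesis by simp
      qed (use V(1) in auto)
      hence "(P *v x) $ q = x $ q"
        by (simp add: matrix_vector_mult_def P_def)
      with x q(1) show False by simp
    qed
  qed
qed

text \<open>Since \<open>x ** x = 0\<close>, the matrices \<open>mat 1 + x\<close> and
  \<open>mat 1 - x\<close> are inverse to each other.\<close>

lemma similar_unipotent:
  fixes x :: "'a::comm_ring_1^'n::finite^'n"
  assumes "x ** x = 0"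
  shows "similar_matrix (M + x ** M - M ** x - x ** M ** x) M"
proof -
  have 1: "(mat 1 + x) ** (mat 1 - x) = mat 1" "(mat 1 - x) ** (mat 1 + x) = mat 1"
    by (simp_all add: matrix_mult_add_left matrix_mult_diff_left matrix_add_ldistrib matrix_mult_diff_right assms)
  have 2: "M + x ** M - M ** x - x ** M ** x = (mat 1 + x) ** M ** (mat 1 - x)"
    by (simp add: matrix_mult_add_left matrix_mult_diff_right algebra_simps)
  show ?thesis unfolding similar_matrix_def 2
    by (rule exI[of _ "mat 1 + x"], rule exI[of _ "mat 1 - x"]) (simp add: 1)
qed

text \<open>Conjugation by a transvection. On the diagonal only the entries at \<open>r\<close> and
  \<open>s\<close> change, by opposite amounts \<open>t * M $ s $ r\<close>.\<close>

lemma similar_elementary: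
  fixes M :: "'a::comm_ring_1^'n::finite^'n"
  assumes "r \<noteq> s"
  shows "\<exists>N. similar_matrix N M \<and> (\<forall>p q. N $ p $ q = M $ p $ q + (if p = r then t * M $ s $ q else 0) -
    (if q = s then t * M $ p $ r else 0) - (if p = r \<and> q = s then t * t * M $ s $ r else 0))"
proof -
  define x where "x = (\<chi> p q. if p = r \<and> q = s then t else 0)"
  have xl: "(x ** A) $ p $ q = (if p = r then t * A $ s $ q else 0)" for A :: "'a^'n^'n" and p q
    by (simp add: x_def matrix_matrix_mult_def if_distrib[of "\<lambda>u. u * _"] cong: if_cong)
  have xr: "(A ** x) $ p $ q = (if q = s then t * A $ p $ r else 0)" for A :: "'a^'n^'n" and p q
    by (simp add: x_def matrix_matrix_mult_def if_distrib mult.commute cong: if_cong)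
  have "x ** x = 0" unfolding vec_eq_iff using assms by (simp add: xl) (simp add: x_def)
  from similar_unipotent[OF this, of M] show ?thesis
    by (intro exI[of _ "M + x ** M - M ** x - x ** M ** x"] conjI) (simp_all add: xl xr mult.assoc)
qed

text \<open>The diagonal is cleared position by position. A nonzero entry linking \<open>q\<close>
  to some \<open>s\<close> outside \<open>K\<close> lets a transvection move the diagonal entry from
  \<open>q\<close> to \<open>s\<close>. Without such an entry, two unequal diagonal entries outside
  \<open>K\<close> produce one; if these are all equal, trace zero makes them vanish.\<close>

lemma similar_zero_diagonal:
  fixes M :: "'a::field_char_0^'n::finite^'n"
  assumes "trace M = 0"
  shows "\<exists>N. similar_matrix N M \<and> (\<forall>p. N $ p $ p = 0)"
proof -
  have "\<exists>N. similar_matrix N M \<and> (\<forall>p\<in>K. N $ p $ p = 0)" if "finite K" for K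
    using that
  proof (induction K rule: finite_induct)
    case empty
    show ?case using similar_matrix_refl by auto
  next
    case (insert q K)
    then obtain N where N: "similar_matrix N M" "\<And>p. p \<in> K \<Longrightarrow> N $ p $ p = 0" by blast
    \<comment> \<open>Stated for an arbitrary \<open>N\<close>, since it is applied both to the
      matrix from the induction hypothesis and to a further conjugate of it.\<close>
    have *: "\<exists>N. similar_matrix N M \<and> (\<forall>p\<in>insert q K. N $ p $ p = 0)"
      if N: "similar_matrix N M" "\<And>p. p \<in> K \<Longrightarrow> N $ p $ p = 0"
        and s: "s \<notin> K" "s \<noteq> q" "N $ q $ s \<noteq> 0 \<or> N $ s $ q \<noteq> 0" for N s
    proof (cases "N $ s $ q = 0")
      case False
      define t where "t = - N $ q $ q / N $ s $ q"
      from similar_elementary[of q s N t] s(2) obtain N' where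
        N': "similar_matrix N' N" "\<And>p r. N' $ p $ r = N $ p $ r + (if p = q then t * N $ s $ r else 0) -
    (if r = s then t * N $ p $ q else 0) - (if p = q \<and> r = s then t * t * N $ s $ q else 0)" by blast
      have "N' $ p $ p = 0" if "p \<in> insert q K" for p
        using that N(2)[of p] s(1,2) insert.hyps False by (auto simp: N'(2) t_def)
      with similar_matrix_trans[OF N'(1) N(1)] show ?thesis by blast
    next
      case True
      with s have nz: "N $ q $ s \<noteq> 0" by simp
      define t where "t = N $ q $ q / N $ q $ s"
      from similar_elementary[of s q N t] s(2) obtain N' where
        N': "similar_matrix N' N" "\<And>p r. N' $ p $ r = N $ p $ r + (if p = s then t * N $ q $ r else 0) -
    (if r = q then t * N $ p $ s else 0) - (if p = s \<and> r = q then t * t * N $ q $ s else 0)" by blast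
      have "N' $ p $ p = 0" if "p \<in> insert q K" for p
        using that N(2)[of p] s(1,2) insert.hyps nz by (auto simp: N'(2) t_def)
      with similar_matrix_trans[OF N'(1) N(1)] show ?thesis by blast
    qed
    show ?case
    proof (cases "\<exists>s. s \<notin> K \<and> s \<noteq> q \<and> (N $ q $ s \<noteq> 0 \<or> N $ s $ q \<noteq> 0)")
      case True
      thus ?thesis using *[OF N] by blast
    next
      case no_off: False
      show ?thesis
      proof (cases "\<exists>s. s \<notin> K \<and> N $ s $ s \<noteq> N $ q $ q")
        case True
        then obtain s where s: "s \<notin> K" "N $ s $ s \<noteq> N $ q $ q" by blast
        hence "s \<noteq> q" by auto
        with no_off s have z: "N $ q $ s = 0" "N $ s $ q = 0" by blast+
        \<comment> \<open>With \<open>t = 1\<close> the entry at \<open>(q, s)\<close> becomes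
          \<open>N $ s $ s - N $ q $ q\<close>, while the diagonal stays as it was because
          \<open>N $ s $ q = 0\<close>.\<close>
        from similar_elementary[of q s N 1] \<open>s \<noteq> q\<close> obtain N' where
          N': "similar_matrix N' N" "\<And>p r. N' $ p $ r = N $ p $ r + (if p = q then 1 * N $ s $ r else 0) -
    (if r = s then 1 * N $ p $ q else 0) - (if p = q \<and> r = s then 1 * 1 * N $ s $ q else 0)" by metis
        show ?thesis
        proof (rule *[of N' s])
          show "similar_matrix N' M" by (rule similar_matrix_trans) fact+
          show "N' $ p $ p = 0" if "p \<in> K" for p
            using that N(2)[of p] s insert.hyps by (auto simp: N'(2))
          show "N' $ q $ s \<noteq> 0 \<or> N' $ s $ q \<noteq> 0"
            using s z \<open>s \<noteq> q\<close> by (simp add: N'(2))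
        qed fact+
      next
        case False
        have "0 = trace N" using trace_similar_matrix[OF N(1)] assms by simp
        also have "\<dots> = (\<Sum>p\<in>UNIV. if p \<in> K then 0 else N $ q $ q)"
          unfolding trace_def using N(2) False by (intro sum.cong) auto
        also have "\<dots> = of_nat (card (- K)) * N $ q $ q"
          by (simp add: sum.If_cases)
        finally have "of_nat (card (- K)) * N $ q $ q = 0" by simp
        moreover have "card (- K) \<noteq> 0" using insert.hyps by auto
        ultimately have "N $ q $ q = 0" by simp
        with N show ?thesis by blast
      qed
    qed
  qed
  from this[of UNIV] show ?thesis by simp
qed

section \<open>Trace zero matrices as combinations of conjugates\<close>

text \<open>The term \<open>x ** b ** x\<close> is the same for \<open>x\<close> and
  \<open>- x\<close>, so it cancels in half the difference of the two conjugates.\<close>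

lemma commutator_lincombs:
  fixes b :: "'a::field_char_0^'n::finite^'n"
  assumes b: "b \<in> S" and closed: "\<And>A B. A \<in> S \<Longrightarrow> similar_matrix B A \<Longrightarrow> B \<in> S"
    and x: "x ** x = 0"
  shows "x ** b - b ** x \<in> lincombs 2 S"
proof -
  let ?v = "b + x ** b - b ** x - x ** b ** x" and ?w = "b - x ** b + b ** x - x ** b ** x"
  have neg: "(- x) ** A = - (x ** A)" "A ** (- x) = - (A ** x)" for A
    by (simp_all add: vec_eq_iff matrix_matrix_mult_def sum_negf)
  have neg2: "- A ** x = - (A ** x)" for A
    by (simp_all add: vec_eq_iff matrix_matrix_mult_def sum_negf)
  have "?v \<in> S" by (rule closed[OF b similar_unipotent[OF x]])
  moreover have "?w \<in> S"
    using similar_unipotent[of "- x" b] x by (intro closed[OF b]) (simp add: neg neg2)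
  ultimately have "smult_matrix (1/2) ?v + smult_matrix (-1/2) ?w \<in> lincombs (1 + 1) S"
    by (intro lincombs_add lincombs_1)
  also have "smult_matrix (1/2) ?v + smult_matrix (-1/2) ?w = x ** b - b ** x"
    by (simp add: vec_eq_iff field_simps)
  finally show ?thesis by (simp add: numeral_2_eq_2)
qed

text \<open>The matrix \<open>x\<close> sends the basis vector at \<open>\<sigma> a\<close> to
  \<open>d a\<close> times the one at \<open>a\<close> and kills all others. With \<open>A\<close>
  ordered first, the commutator is block upper triangular with diagonal blocks that are themselves
  diagonal: \<open>t * d a\<close> at \<open>a\<close>, \<open>- t * d a\<close> at
  \<open>\<sigma> a\<close>, and 0 elsewhere.\<close>

lemma commutator_entries:
  fixes b :: "'a::field^'n::finite^'n" and d :: "'n \<Rightarrow> 'a"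
  assumes b: "\<forall>a\<in>A. \<forall>p. b $ p $ a = (if p = a then s else if p = \<sigma> a then t else 0)"
    and \<sigma>: "inj_on \<sigma> A" "\<sigma> ` A \<inter> A = {}"
  defines "x \<equiv> (\<chi> p q. if p \<in> A \<and> q = \<sigma> p then d p else 0)"
  shows "x ** x = 0"
    and "q \<in> A \<Longrightarrow> (x ** b - b ** x) $ p $ q = (if p = q then t * d q else 0)"
    and "p \<notin> A \<Longrightarrow> a \<in> A \<Longrightarrow> (x ** b - b ** x) $ p $ \<sigma> a = (if p = \<sigma> a then - t * d a else 0)"
    and "p \<notin> A \<Longrightarrow> q \<notin> A \<Longrightarrow> q \<notin> \<sigma> ` A \<Longrightarrow> (x ** b - b ** x) $ p $ q = 0"
proof -
  have xl: "(x ** B) $ p $ q = (if p \<in> A then d p * B $ \<sigma> p $ q else 0)" for B :: "'a^'n^'n" and p q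
    by (simp add: x_def matrix_matrix_mult_def if_distrib[of "\<lambda>u. u * _"] cong: if_cong)
  have xr1: "(B ** x) $ p $ \<sigma> a = d a * B $ p $ a" if "a \<in> A" for B :: "'a^'n^'n" and p a
  proof -
    have "(r \<in> A \<and> \<sigma> a = \<sigma> r) = (r = a)" for r
      using that \<sigma> by (auto dest: inj_onD)
    thus ?thesis
      by (simp add: x_def matrix_matrix_mult_def if_distrib mult.commute cong: if_cong)
  qed
  have xr0: "(B ** x) $ p $ q = 0" if "q \<notin> \<sigma> ` A" for B :: "'a^'n^'n" and p q
    using that by (auto simp: x_def matrix_matrix_mult_def intro!: sum.neutral)
  have \<sigma>A: "\<sigma> p \<notin> A" if "p \<in> A" for p using that \<sigma> by blast
  show "x ** x = 0"
    unfolding vec_eq_iff by (simp add: xl) (auto simp: x_def \<sigma>A)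
  show "(x ** b - b ** x) $ p $ q = (if p = q then t * d q else 0)" if q: "q \<in> A"
  proof -
    have "q \<notin> \<sigma> ` A" using \<sigma> q by blast
    have "\<sigma> p \<noteq> q" if "p \<in> A" using \<sigma> q that by blast
    moreover have "\<sigma> p = \<sigma> q \<longleftrightarrow> p = q" if "p \<in> A" using \<sigma> q that by (auto dest: inj_onD)
    moreover have "\<sigma> q \<noteq> q" using \<sigma>A[OF q] q by auto
    ultimately show ?thesis using q
      by (simp add: xl xr0[OF \<open>q \<notin> \<sigma> ` A\<close>] b q mult.commute)
  qed
  show "(x ** b - b ** x) $ p $ \<sigma> a = (if p = \<sigma> a then - t * d a else 0)" if "p \<notin> A" "a \<in> A"
    using that by (auto simp: xl xr1 b)
  show "(x ** b - b ** x) $ p $ q = 0" if "p \<notin> A" "q \<notin> A" "q \<notin> \<sigma> ` A"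
    using that by (simp add: xl xr0)
qed

lemma diag_matrix_lincombs:
  fixes b :: "'a::field_char_0^'n::finite^'n"
  assumes b: "\<forall>a\<in>A. \<forall>p. b $ p $ a = (if p = a then s else if p = \<sigma> a then t else 0)"
    and t: "t \<noteq> 0" and \<sigma>: "inj_on \<sigma> A" "\<sigma> ` A \<inter> A = {}" and card: "CARD('n) \<le> 3 * card A"
    and S: "b \<in> S" and closed: "\<And>A B. A \<in> S \<Longrightarrow> similar_matrix B A \<Longrightarrow> B \<in> S"
  shows "\<exists>h. inj h \<and> diag_matrix h \<in> lincombs 4 S"
proof -
  let ?R = "- (A \<union> \<sigma> ` A)"
  have cR: "card ?R \<le> card (\<sigma> ` A)"
  proof -
    have "card (A \<union> \<sigma> ` A) = 2 * card A"
      using \<sigma> by (subst card_Un_disjoint) (auto simp: card_image)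
    thus ?thesis using card \<sigma>(1) by (simp add: card_image Compl_eq_Diff_UNIV card_Diff_subset)
  qed
  then obtain B where B: "B \<subseteq> \<sigma> ` A" "card B = card ?R"
    by (metis obtain_subset_with_card_n)
  then obtain g where g: "bij_betw g B ?R"
    using finite_same_card_bij[of B ?R] by auto
  \<comment> \<open>The involution exchanging \<open>B\<close> with \<open>?R\<close> and fixing all
    other indices, in particular those in \<open>A\<close>.\<close>
  define \<pi> where "\<pi> p = (if p \<in> B then g p else if p \<in> ?R then inv_into B g p else p)" for p
  have gB: "g p \<in> ?R" if "p \<in> B" for p using g that by (auto simp: bij_betw_def)
  have gR: "inv_into B g p \<in> B" "g (inv_into B g p) = p" if "p \<in> ?R" for p
    using g that by (auto simp: bij_betw_def f_inv_into_f inv_into_into)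
  have gi: "inv_into B g (g p) = p" if "p \<in> B" for p
    using g that by (auto simp: bij_betw_def)
  have BR: "B \<inter> ?R = {}" "B \<inter> A = {}" using B \<sigma> by auto
  have \<pi>\<pi> [simp]: "\<pi> (\<pi> p) = p" for p
  proof (cases "p \<in> B \<or> p \<in> ?R")
    case True
    thus ?thesis
    proof
      assume p: "p \<in> B"
      hence "\<pi> p = g p" "g p \<notin> B" using gB[OF p] BR by (auto simp: \<pi>_def)
      thus ?thesis using gB[OF p] gi[OF p] by (simp add: \<pi>_def)
    next
      assume p: "p \<in> ?R"
      hence "\<pi> p = inv_into B g p" using BR by (auto simp: \<pi>_def)
      thus ?thesis using gR[OF p] by (simp add: \<pi>_def)
    qed
  qed (auto simp: \<pi>_def)
  have \<pi>A: "\<pi> a = a" if "a \<in> A" for a using that BR by (auto simp: \<pi>_def)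
  have \<pi>R: "?R \<subseteq> \<pi> ` \<sigma> ` A"
  proof
    fix p assume p: "p \<in> ?R"
    hence "\<pi> p = inv_into B g p" using BR by (auto simp: \<pi>_def)
    hence "\<pi> p \<in> \<sigma> ` A" using gR[OF p] B by auto
    thus "p \<in> \<pi> ` \<sigma> ` A" by (metis \<pi>\<pi> imageI)
  qed
  define b' where "b' = (\<chi> p q. b $ \<pi> p $ \<pi> q)"
  have b': "b' $ p $ a = (if p = a then s else if p = \<pi> (\<sigma> a) then t else 0)" if "a \<in> A" for a p
  proof -
    have "\<pi> p = a \<longleftrightarrow> p = a" "\<pi> p = \<sigma> a \<longleftrightarrow> p = \<pi> (\<sigma> a)" using \<pi>A[OF that] \<pi>\<pi> by metis+
    thus ?thesis using that by (simp add: b'_def \<pi>A b)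
  qed
  have "b' \<in> S"
  proof -
    \<comment> \<open>The permutation matrix of \<open>\<pi>\<close>, which is its own
      inverse.\<close>
    define Q where "Q = (\<chi> p q. if q = \<pi> p then 1 else (0 :: 'a))"
    have Ql: "(Q ** X) $ p $ q = X $ \<pi> p $ q" for X :: "'a^'n^'n" and p q
      by (simp add: Q_def matrix_matrix_mult_def if_distrib[of "\<lambda>u. u * _"] cong: if_cong)
    have Qr: "(X ** Q) $ p $ q = X $ p $ \<pi> q" for X :: "'a^'n^'n" and p q
    proof -
      have "q = \<pi> r \<longleftrightarrow> r = \<pi> q" for r using \<pi>\<pi> by metis
      thus ?thesis by (simp add: Q_def matrix_matrix_mult_def if_distrib cong: if_cong)
    qed
    have "Q ** Q = mat 1" unfolding vec_eq_iff by (simp add: Ql) (simp add: Q_def mat_def eq_commute)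
    moreover have "b' = Q ** b ** Q" unfolding vec_eq_iff by (simp add: Qr Ql b'_def)
    ultimately have "similar_matrix b' b" unfolding similar_matrix_def by blast
    with S closed show ?thesis by blast
  qed
  define \<tau> where "\<tau> = \<pi> \<circ> \<sigma>"
  have inj\<pi>: "inj \<pi>" by (metis \<pi>\<pi> injI)
  have \<tau>: "inj_on \<tau> A" "\<tau> ` A \<inter> A = {}"
  proof -
    show "inj_on \<tau> A" unfolding \<tau>_def using \<sigma> inj\<pi> by (auto intro: comp_inj_on inj_on_subset)
    have "\<pi> (\<sigma> a) \<notin> A" if "a \<in> A" for a
      using \<pi>A[of "\<pi> (\<sigma> a)"] \<sigma> that by auto
    thus "\<tau> ` A \<inter> A = {}" by (auto simp: \<tau>_def)
  qed
  have cover: "q \<in> \<sigma> ` A \<or> q \<in> \<tau> ` A" if "q \<notin> A" for q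
    using that \<pi>R by (auto simp: \<tau>_def)
  have b'': "\<forall>a\<in>A. \<forall>p. b' $ p $ a = (if p = a then s else if p = \<tau> a then t else 0)"
    using b' by (simp add: \<tau>_def)
  obtain e0 :: "'n \<Rightarrow> nat" where e0: "bij_betw e0 A {0..<card A}"
    using ex_bij_betw_finite_nat[of A] by auto
  \<comment> \<open>Numbering starts at 1 so that 0 can mean "no preimage" in \<open>u\<close>
    below; \<open>N\<close> exceeds all numbers, so they serve as digits in base
    \<open>N\<close>.\<close>
  define e where "e a = Suc (e0 a)" for a
  define N where "N = Suc (card A)"
  have e: "inj_on e A" "\<And>a. a \<in> A \<Longrightarrow> e a < N" "\<And>a. 0 < e a"
    using e0 by (auto simp: bij_betw_def inj_on_def e_def N_def)
  define d1 :: "'n \<Rightarrow> 'a" where "d1 a = of_nat (e a)" for a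
  \<comment> \<open>The factor \<open>N\<close> puts the second commutator into the next base
    \<open>N\<close> digit.\<close>
  define d2 :: "'n \<Rightarrow> 'a" where "d2 a = of_nat (N * e a)" for a
  define x1 :: "'a^'n^'n" where "x1 = (\<chi> p q. if p \<in> A \<and> q = \<sigma> p then d1 p else 0)"
  define x2 :: "'a^'n^'n" where "x2 = (\<chi> p q. if p \<in> A \<and> q = \<tau> p then d2 p else 0)"
  note c1 = commutator_entries[OF b \<sigma>, where d = d1, folded x1_def]
  note c2 = commutator_entries[OF b'' \<tau>, where d = d2, folded x2_def]
  define D where "D = (x1 ** b - b ** x1) + (x2 ** b' - b' ** x2)"
  have D: "D \<in> lincombs 4 S"
    using lincombs_add[OF commutator_lincombs[OF S closed c1(1)] commutator_lincombs[OF \<open>b' \<in> S\<close> closed c2(1)]]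
    by (simp add: D_def)
  define u where "u \<rho> q = (if q \<in> \<rho> ` A then e (inv_into A \<rho> q) else 0)" for \<rho> :: "'n \<Rightarrow> 'n" and q
  have u: "u \<rho> q < N" for \<rho> q
    using e(2) by (auto simp: u_def inv_into_into N_def)
  have u_inj: "q = q'" if "u \<rho> q = u \<rho> q'" "u \<rho> q \<noteq> 0" for \<rho> q q'
  proof -
    have "q \<in> \<rho> ` A" "q' \<in> \<rho> ` A" using that by (auto simp: u_def split: if_splits)
    thus ?thesis using that e(1) by (auto simp: u_def dest!: inj_onD intro: inv_into_into inv_into_injective)
  qed
  have u0: "u \<rho> q \<noteq> 0" if "q \<in> \<rho> ` A" for \<rho> q
    using that e(3) by (auto simp: u_def neq0_conv)
  \<comment> \<open>The diagonal of \<open>D\<close>. Off \<open>A\<close> its digits in base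
    \<open>N\<close> are the numbers of the preimages of \<open>q\<close> under
    \<open>\<sigma>\<close> and \<open>\<tau>\<close>.\<close>
  define h where "h q = t * (if q \<in> A then of_nat (Suc N * e q) else - of_nat (u \<sigma> q + N * u \<tau> q))" for q
  have h: "inj h"
  proof (rule injI)
    fix q q' assume eq: "h q = h q'"
    \<comment> \<open>In characteristic zero a positive integer is never equal to a nonpositive one,
      which separates \<open>A\<close> from its complement.\<close>
    have mixed: False if "of_nat (Suc N * e q) = (- of_nat k :: 'a)" for q k
    proof -
      from that have "of_nat (Suc N * e q + k) = (0 :: 'a)" unfolding of_nat_add by simp
      hence "Suc N * e q + k = 0" by (simp only: of_nat_eq_0_iff)
      thus False using e(3)[of q] by simp
    qed
    show "q = q'"
    proof (cases "q \<in> A"; cases "q' \<in> A")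
      assume q: "q \<in> A" "q' \<in> A"
      with eq t have "Suc N * e q = Suc N * e q'"
        by (simp only: h_def if_True mult_cancel_left of_nat_eq_iff) auto
      hence "e q = e q'" by (simp only: mult_cancel1) auto
      with e(1) q show ?thesis by (auto dest: inj_onD)
    next
      assume q: "q \<in> A" "q' \<notin> A"
      with eq t have "of_nat (Suc N * e q) = (- of_nat (u \<sigma> q' + N * u \<tau> q') :: 'a)"
        by (simp only: h_def if_True if_False mult_cancel_left) auto
      with mixed show ?thesis by blast
    next
      assume q: "q \<notin> A" "q' \<in> A"
      with eq t have "of_nat (Suc N * e q') = (- of_nat (u \<sigma> q + N * u \<tau> q) :: 'a)"
        by (simp only: h_def if_True if_False mult_cancel_left) auto
      with mixed show ?thesis by blast
    next
      assume q: "q \<notin> A" "q' \<notin> A"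
      with eq t have "(of_nat (u \<sigma> q + N * u \<tau> q) :: 'a) = of_nat (u \<sigma> q' + N * u \<tau> q')"
        by (simp only: h_def if_False mult_cancel_left neg_equal_iff_equal) auto
      hence *: "u \<sigma> q + N * u \<tau> q = u \<sigma> q' + N * u \<tau> q'" by (simp only: of_nat_eq_iff)
      have 1: "u \<sigma> q = u \<sigma> q'"
        using arg_cong[OF *, of "\<lambda>k. k mod N"] u by simp
      with * have "N * u \<tau> q = N * u \<tau> q'" by linarith
      hence 2: "u \<tau> q = u \<tau> q'" unfolding mult_cancel1 by (simp add: N_def)
      \<comment> \<open>By \<open>cover\<close> at least one digit is nonzero, and a nonzero digit
        determines the index.\<close>
      from cover[OF q(1)] u0 have "u \<sigma> q \<noteq> 0 \<or> u \<tau> q \<noteq> 0" by blast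
      with 1 2 u_inj show ?thesis by blast
    qed
  qed
  have Dent: "D $ p $ q = (if p = q then h q else 0)" if pq: "p \<notin> A \<or> q \<in> A" for p q
  proof (cases "q \<in> A")
    case True
    show ?thesis unfolding D_def vector_add_component c1(2)[OF True] c2(2)[OF True] using True
      by (simp add: h_def d1_def d2_def algebra_simps)
  next
    case False
    with pq have p: "p \<notin> A" by simp
    have e1: "(x1 ** b - b ** x1) $ p $ q = (if p = q then - t * of_nat (u \<sigma> q) else 0)"
    proof (cases "q \<in> \<sigma> ` A")
      case True
      then obtain a where a: "a \<in> A" "q = \<sigma> a" by blast
      hence "u \<sigma> q = e a" using \<sigma> by (simp add: u_def)
      thus ?thesis using c1(3)[OF p a(1)] a by (simp add: d1_def)
    next
      case q: False
      thus ?thesis using c1(4)[OF p False q] by (simp add: u_def)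
    qed
    have e2: "(x2 ** b' - b' ** x2) $ p $ q = (if p = q then - t * of_nat (N * u \<tau> q) else 0)"
    proof (cases "q \<in> \<tau> ` A")
      case True
      then obtain a where a: "a \<in> A" "q = \<tau> a" by blast
      hence "u \<tau> q = e a" using \<tau> by (simp add: u_def)
      thus ?thesis using c2(3)[OF p a(1)] a by (simp add: d2_def)
    next
      case q: False
      thus ?thesis using c2(4)[OF p False q] by (simp add: u_def)
    qed
    show ?thesis unfolding D_def vector_add_component e1 e2 using False by (simp add: h_def algebra_simps)
  qed
  obtain \<phi> :: "'n \<Rightarrow> nat" where \<phi>: "bij_betw \<phi> UNIV {0..<CARD('n)}"
    using ex_bij_betw_finite_nat[of "UNIV :: 'n set"] by auto
  \<comment> \<open>All of \<open>A\<close> comes before its complement, so the uncontrolled entries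
    of \<open>D\<close> lie above the diagonal.\<close>
  define \<psi> where "\<psi> p = (if p \<in> A then 0 else CARD('n)) + \<phi> p" for p
  have \<phi>lt: "\<phi> p < CARD('n)" for p using \<phi> by (auto simp: bij_betw_def)
  have "inj \<psi>"
  proof (rule injI)
    fix p q assume "\<psi> p = \<psi> q"
    hence "\<phi> p = \<phi> q" using \<phi>lt[of p] \<phi>lt[of q] by (auto simp: \<psi>_def split: if_splits)
    thus "p = q" using \<phi> by (auto simp: bij_betw_def dest: injD)
  qed
  moreover have "\<psi> p \<le> \<psi> q" if "D $ p $ q \<noteq> 0" for p q
    using that Dent[of p q] \<phi>lt[of p] by (auto simp: \<psi>_def split: if_splits)
  moreover have "D $ p $ p = h p" for p using Dent[of p p] by auto
  ultimately have "similar_matrix D (diag_matrix h)"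
    using h by (intro triangular_similar_diag_matrix) auto
  from D similar_matrix_sym[OF this] have "diag_matrix h \<in> lincombs 4 S"
    by (rule lincombs_similar) (rule closed)
  with h show ?thesis by blast
qed

lemma trace_zero_lincombs:
  fixes T :: "'a::field_char_0^'n::finite^'n"
  assumes h: "inj h" "diag_matrix h \<in> lincombs k S" and T: "trace T = 0"
    and closed: "\<And>A B. A \<in> S \<Longrightarrow> similar_matrix B A \<Longrightarrow> B \<in> S"
  shows "T \<in> lincombs (k + k) S"
proof -
  obtain N where N: "similar_matrix N T" "\<And>p. N $ p $ p = 0"
    using similar_zero_diagonal[OF T] by blast
  obtain \<phi> :: "'n \<Rightarrow> nat" where \<phi>: "bij_betw \<phi> UNIV {0..<CARD('n)}"
    using ex_bij_betw_finite_nat[of "UNIV :: 'n set"] by auto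
  have inj: "inj \<phi>" using \<phi> by (auto simp: bij_betw_def)
  have \<phi>lt: "\<phi> p < CARD('n)" for p using \<phi> by (auto simp: bij_betw_def)
  \<comment> \<open>Here \<open>U\<close> and \<open>L\<close> include the diagonal
    \<open>h\<close>, so they are the matrices \<open>D + U\<close> and \<open>D - L\<close> of the
    overview.\<close>
  define U where "U = (\<chi> p q. if p = q then h p else if \<phi> p < \<phi> q then N $ p $ q else 0)"
  define L where "L = (\<chi> p q. if p = q then h p else if \<phi> q < \<phi> p then - N $ p $ q else 0)"
  have "similar_matrix U (diag_matrix h)"
    by (rule triangular_similar_diag_matrix[OF inj _ _ h(1)]) (auto simp: U_def split: if_splits)
  hence U: "U \<in> lincombs k S" by (rule lincombs_similar[OF h(2)]) (rule closed)
  \<comment> \<open>Reversing the numbering turns lower triangular into upper triangular.\<close>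
  have "similar_matrix L (diag_matrix h)"
  proof (rule triangular_similar_diag_matrix[OF _ _ _ h(1), of "\<lambda>p. CARD('n) - \<phi> p"])
    show "inj (\<lambda>p. CARD('n) - \<phi> p)"
    proof (rule injI)
      fix p q assume "CARD('n) - \<phi> p = CARD('n) - \<phi> q"
      with \<phi>lt[of p] \<phi>lt[of q] have "\<phi> p = \<phi> q" by linarith
      with inj show "p = q" by (rule injD)
    qed
  qed (auto simp: L_def split: if_splits)
  hence L: "L \<in> lincombs k S" by (rule lincombs_similar[OF h(2)]) (rule closed)
  have "N $ p $ q = (U - L) $ p $ q" for p q
  proof -
    consider "p = q" | "\<phi> p < \<phi> q" "p \<noteq> q" | "\<phi> q < \<phi> p" "p \<noteq> q"
      using inj by (metis injD linorder_less_linear)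
    thus ?thesis by cases (simp_all add: U_def L_def N(2))
  qed
  hence "N = U - L" by (simp add: vec_eq_iff)
  with lincombs_diff[OF U L] have "N \<in> lincombs (k + k) S" by simp
  from this similar_matrix_sym[OF N(1)] show ?thesis by (rule lincombs_similar) (rule closed)
qed

section \<open>Polynomial functions\<close>

text \<open>Working with functions rather than polynomial matrices lets matrix products and
  determinants be treated pointwise in the parameter.\<close>

definition poly_fun :: "('a::comm_ring_1 \<Rightarrow> 'a) \<Rightarrow> bool" where
  "poly_fun p \<longleftrightarrow> (\<exists>P. \<forall>t. p t = poly P t)"

lemma poly_fun_const [intro]: "poly_fun (\<lambda>_. c)"
  unfolding poly_fun_def by (rule exI[of _ "[:c:]"]) simp

lemma poly_fun_id [intro]: "poly_fun (\<lambda>t. t)"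
  unfolding poly_fun_def by (rule exI[of _ "[:0, 1:]"]) simp

lemma poly_fun_add [intro]:
  assumes "poly_fun p" "poly_fun q"
  shows "poly_fun (\<lambda>t. p t + q t)"
  using assms unfolding poly_fun_def by (metis poly_add)

lemma poly_fun_mult [intro]:
  assumes "poly_fun p" "poly_fun q"
  shows "poly_fun (\<lambda>t. p t * q t)"
  using assms unfolding poly_fun_def by (metis poly_mult)

lemma poly_fun_power [intro]:
  assumes "poly_fun p"
  shows "poly_fun (\<lambda>t. p t ^ k)"
  using assms unfolding poly_fun_def by (metis poly_power)

lemma poly_fun_sum [intro]:
  assumes "\<And>i. i \<in> I \<Longrightarrow> poly_fun (p i)"
  shows "poly_fun (\<lambda>t. \<Sum>i\<in>I. p i t)"
  using assms by (induction I rule: infinite_finite_induct) auto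

lemma poly_fun_prod [intro]:
  assumes "\<And>i. i \<in> I \<Longrightarrow> poly_fun (p i)"
  shows "poly_fun (\<lambda>t. \<Prod>i\<in>I. p i t)"
  using assms by (induction I rule: infinite_finite_induct) auto

text \<open>Replaces differentiation at 0: over an infinite field, a polynomial vanishing everywhere
  has zero coefficients.\<close>

lemma linear_coeff_eq_0:
  fixes c\<^sub>0 c\<^sub>1 :: "'a::field_char_0"
  assumes "poly_fun r" "\<And>t. c\<^sub>0 + t * c\<^sub>1 + t * t * r t = 0"
  shows "c\<^sub>1 = 0"
proof -
  from assms(1) obtain R where "r = poly R" unfolding poly_fun_def by blast
  with assms(2) have "poly (pCons c\<^sub>0 (pCons c\<^sub>1 R)) t = 0" for t
    by (simp add: distrib_left mult.assoc add.assoc)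
  hence "pCons c\<^sub>0 (pCons c\<^sub>1 R) = 0" using poly_all_0_iff_0 by blast
  thus ?thesis by simp
qed

text \<open>The claimed sum is the coefficient of degree \<open>k\<close> of a polynomial that
  vanishes everywhere.\<close>

lemma graded_sum_eq_0:
  fixes c :: "_ \<Rightarrow> 'a::field_char_0"
  assumes "finite I" "\<And>t. (\<Sum>i\<in>I. t ^ d i * c i) = 0"
  shows "(\<Sum>i\<in>{i\<in>I. d i = k}. c i) = 0"
proof -
  let ?P = "\<Sum>i\<in>I. monom (c i) (d i)"
  have "poly ?P t = 0" for t
    using assms(2)[of t] by (simp add: poly_sum poly_monom mult.commute)
  hence "?P = 0" using poly_all_0_iff_0 by blast
  hence "0 = coeff ?P k" by simp
  also have "\<dots> = (\<Sum>i\<in>I. if d i = k then c i else 0)" by (simp add: coeff_sum)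
  also have "\<dots> = (\<Sum>i\<in>{i\<in>I. d i = k}. c i)"
    using assms(1) by (simp add: sum.inter_filter)
  finally show ?thesis by simp
qed

text \<open>If \<open>p\<close> vanished away from 0, then \<open>t * p t\<close> would vanish
  everywhere.\<close>

lemma poly_fun_nonzero:
  fixes p :: "'a::field_char_0 \<Rightarrow> 'a"
  assumes "poly_fun p" "p 0 \<noteq> 0"
  shows "\<exists>t. t \<noteq> 0 \<and> p t \<noteq> 0"
proof (rule ccontr)
  assume no: "\<not> ?thesis"
  from assms obtain P where P: "p = poly P" unfolding poly_fun_def by blast
  have "poly ([:0, 1:] * P) t = 0" for t
    using no P by (cases "t = 0") auto
  hence "[:0, 1:] * P = 0" using poly_all_0_iff_0 by blast
  hence "P = 0" by simp
  with assms P show False by simp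
qed

lemma poly_fun_matrix_mult:
  fixes A B :: "'a::comm_ring_1 \<Rightarrow> 'a^'n::finite^'n"
  assumes "\<And>p q. poly_fun (\<lambda>t. A t $ p $ q)" "\<And>p q. poly_fun (\<lambda>t. B t $ p $ q)"
  shows "poly_fun (\<lambda>t. (A t ** B t) $ p $ q)"
  unfolding matrix_matrix_mult_def using assms by (auto intro!: poly_fun_sum poly_fun_mult)

lemma poly_fun_det:
  fixes A :: "'a::comm_ring_1 \<Rightarrow> 'a^'n::finite^'n"
  assumes "\<And>p q. poly_fun (\<lambda>t. A t $ p $ q)"
  shows "poly_fun (\<lambda>t. det (A t))"
  unfolding det_def by (intro poly_fun_sum poly_fun_mult poly_fun_prod poly_fun_const assms)

section \<open>Polynomials with trace zero values\<close>

text \<open>The derivative at \<open>t = 0\<close> of a word in the matrices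
  \<open>a i ** (mat 1 + t Z)\<close>: \<open>Z\<close> is inserted after each letter in
  turn.\<close>

fun deriv_word :: "(nat \<Rightarrow> 'a::comm_ring_1^'n^'n) \<Rightarrow> 'a^'n^'n \<Rightarrow> nat list \<Rightarrow> 'a^'n^'n" where
  "deriv_word a Z [] = 0"
| "deriv_word a Z (i # w) = a i ** Z ** eval_word a (Word w) + a i ** deriv_word a Z w"

lemma eval_word_perturb:
  fixes a :: "nat \<Rightarrow> 'a::comm_ring_1^'n::finite^'n"
  shows "\<exists>R. (\<forall>p q. poly_fun (\<lambda>t. R t $ p $ q)) \<and>
    (\<forall>t. eval_word (\<lambda>i. a i ** (mat 1 + smult_matrix t Z)) (Word w) =
      eval_word a (Word w) + smult_matrix t (deriv_word a Z w) + smult_matrix (t * t) (R t))"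
proof (induction w)
  case Nil
  show ?case by (rule exI[of _ "\<lambda>_. 0"]) auto
next
  case (Cons i w)
  then obtain R where R: "\<And>p q. poly_fun (\<lambda>t. R t $ p $ q)"
    "\<And>t. eval_word (\<lambda>i. a i ** (mat 1 + smult_matrix t Z)) (Word w) =
      eval_word a (Word w) + smult_matrix t (deriv_word a Z w) + smult_matrix (t * t) (R t)" by blast
  \<comment> \<open>Everything of order at least two in the product of \<open>a i + t a i Z\<close>
    with the expansion for \<open>w\<close>, divided by \<open>t * t\<close>.\<close>
  define R' where "R' t = a i ** R t + a i ** Z ** deriv_word a Z w + smult_matrix t (a i ** Z ** R t)" for t
  have "poly_fun (\<lambda>t. R' t $ p $ q)" for p q
    unfolding R'_def vector_add_component smult_matrix_nth
    by (intro poly_fun_add poly_fun_mult poly_fun_id poly_fun_const poly_fun_matrix_mult R)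
  moreover have "eval_word (\<lambda>i. a i ** (mat 1 + smult_matrix t Z)) (Word (i # w)) =
      eval_word a (Word (i # w)) + smult_matrix t (deriv_word a Z (i # w)) + smult_matrix (t * t) (R' t)" for t
    unfolding eval_word_Cons deriv_word.simps R(2)
    by (simp add: R'_def matrix_add_ldistrib matrix_mult_add_left smult_matrix_mult_left
        smult_matrix_mult_right smult_matrix_add matrix_mul_assoc mult.assoc add_ac)
  ultimately show ?case by blast
qed

text \<open>For \<open>k < length w\<close> each rotation amount from 1 to \<open>length w\<close>
  occurs once; the last one gives \<open>w\<close> itself.\<close>

definition cycle_word :: "nat \<Rightarrow> nat list \<Rightarrow> nat list" where
  "cycle_word k w = drop (Suc k) w @ take (Suc k) w"

lemma deriv_word_eq:
  fixes a :: "nat \<Rightarrow> 'a::comm_ring_1^'n::finite^'n"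
  shows
  "deriv_word a Z w = (\<Sum>k<length w. eval_word a (Word (take (Suc k) w)) ** Z ** eval_word a (Word (drop (Suc k) w)))"
  by (induction w) (simp_all add: sum.lessThan_Suc_shift matrix_mult_sum_right matrix_mul_assoc del: sum.lessThan_Suc)

text \<open>Cyclicity of the trace moves \<open>Z\<close> to the end and thereby turns prefix and
  suffix into a rotation.\<close>

lemma trace_deriv_word:
  fixes a :: "nat \<Rightarrow> 'a::comm_ring_1^'n::finite^'n"
  shows
  "trace (deriv_word a Z w) = trace ((\<Sum>k<length w. eval_word a (Word (cycle_word k w))) ** Z)"
proof -
  have "trace (A ** Z ** B) = trace (B ** A ** Z)" for A B :: "'a^'n^'n"
    using trace_mul_sym[of "A ** Z" B] by (simp add: matrix_mul_assoc)
  thus ?thesis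
    by (simp add: deriv_word_eq trace_sum matrix_mult_sum_left cycle_word_def eval_word_append)
qed

lemma eval_word_scale:
  fixes a :: "nat \<Rightarrow> 'a::comm_ring_1^'n::finite^'n"
  shows "eval_word (\<lambda>i. smult_matrix s (a i)) (Word w) = smult_matrix (s ^ length w) (eval_word a (Word w))"
  by (induction w) (simp_all add: smult_matrix_mult_left smult_matrix_mult_right mult.commute)

lemma length_cycle_word [simp]: "k < length w \<Longrightarrow> length (cycle_word k w) = length w"
  by (simp add: cycle_word_def)

text \<open>
  Replacing every matrix \<open>a i\<close> by \<open>a i (1 + t Z)\<close> and differentiating at \<open>t = 0\<close> turns the vanishing
  of the trace into \<open>tr (H Z) = 0\<close>, where \<open>H\<close> sums all cyclic rotations of all words.
\<close>

lemma cycle_sum_eq_0: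
  fixes f :: "'a::field_char_0 ncpoly"
  assumes tr: "\<And>a :: nat \<Rightarrow> 'a^'n::finite^'n. trace (eval_ncpoly a f) = 0"
  shows "(\<Sum>w\<in>Poly_Mapping.keys f. smult_matrix (Poly_Mapping.lookup f w)
    (\<Sum>k<length (letters w). eval_word (a :: nat \<Rightarrow> 'a^'n^'n) (Word (cycle_word k (letters w))))) = 0"
proof (rule trace_mult_eq_0_imp_eq_0)
  fix Z :: "'a^'n^'n"
  let ?K = "Poly_Mapping.keys f" and ?c = "Poly_Mapping.lookup f"
  have "\<exists>R. \<forall>w. (\<forall>p q. poly_fun (\<lambda>t. R w t $ p $ q)) \<and>
    (\<forall>t. eval_word (\<lambda>i. a i ** (mat 1 + smult_matrix t Z)) w =
      eval_word a w + smult_matrix t (deriv_word a Z (letters w)) + smult_matrix (t * t) (R w t))"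
    by (rule choice) (use eval_word_perturb[of a Z "letters _"] in simp)
  then obtain R where R: "\<And>w p q. poly_fun (\<lambda>t. R w t $ p $ q)"
    "\<And>w t. eval_word (\<lambda>i. a i ** (mat 1 + smult_matrix t Z)) w =
      eval_word a w + smult_matrix t (deriv_word a Z (letters w)) + smult_matrix (t * t) (R w t)" by blast
  have "(\<Sum>w\<in>?K. ?c w * trace (deriv_word a Z (letters w))) = 0"
  proof (rule linear_coeff_eq_0)
    show "poly_fun (\<lambda>t. \<Sum>w\<in>?K. ?c w * trace (R w t))"
      unfolding trace_def by (intro poly_fun_sum poly_fun_mult poly_fun_const R)
    fix t
    have "0 = trace (eval_ncpoly (\<lambda>i. a i ** (mat 1 + smult_matrix t Z)) f)" using tr by simp
    also have "\<dots> = (\<Sum>w\<in>?K. ?c w * trace (eval_word a w)) + t * (\<Sum>w\<in>?K. ?c w * trace (deriv_word a Z (letters w)))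
        + t * t * (\<Sum>w\<in>?K. ?c w * trace (R w t))"
      by (simp add: eval_ncpoly_def trace_sum trace_smult trace_add R(2) sum.distrib sum_distrib_left
          distrib_left mult_ac)
    finally show "(\<Sum>w\<in>?K. ?c w * trace (eval_word a w)) + t * (\<Sum>w\<in>?K. ?c w * trace (deriv_word a Z (letters w)))
        + t * t * (\<Sum>w\<in>?K. ?c w * trace (R w t)) = 0" by simp
  qed
  thus "trace ((\<Sum>w\<in>?K. smult_matrix (?c w)
    (\<Sum>k<length (letters w). eval_word a (Word (cycle_word k (letters w))))) ** Z) = 0"
    by (simp add: matrix_mult_sum_left[of _ ?K] smult_matrix_mult_left trace_sum[of _ ?K] trace_smult trace_deriv_word)
qed

text \<open>Scaling all matrices by \<open>t\<close> multiplies words of length \<open>d\<close> by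
  \<open>t ^ d\<close>. The lengths have to be separated because averaging over rotations divides by
  the length.\<close>

lemma cycle_sum_homogeneous_eq_0:
  fixes f :: "'a::field_char_0 ncpoly"
  assumes tr: "\<And>a :: nat \<Rightarrow> 'a^'n::finite^'n. trace (eval_ncpoly a f) = 0"
  shows "(\<Sum>w\<in>{w\<in>Poly_Mapping.keys f. length (letters w) = d}. smult_matrix (Poly_Mapping.lookup f w)
    (\<Sum>k<length (letters w). eval_word (a :: nat \<Rightarrow> 'a^'n^'n) (Word (cycle_word k (letters w))))) = 0"
    (is "(\<Sum>w\<in>_. ?X w) = 0")
proof -
  have "(\<Sum>w\<in>{w\<in>Poly_Mapping.keys f. length (letters w) = d}. ?X w $ p $ q) = 0" for p q
  proof (rule graded_sum_eq_0)
    fix t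
    have "smult_matrix (Poly_Mapping.lookup f w)
       (\<Sum>k<length (letters w). eval_word (\<lambda>i. smult_matrix t (a i)) (Word (cycle_word k (letters w)))) =
        smult_matrix (t ^ length (letters w)) (?X w)" for w
      by (simp add: eval_word_scale smult_matrix_sum mult.commute)
    with cycle_sum_eq_0[OF tr, of "\<lambda>i. smult_matrix t (a i)"]
    have "(\<Sum>w\<in>Poly_Mapping.keys f. smult_matrix (t ^ length (letters w)) (?X w)) $ p $ q = 0"
      by simp
    thus "(\<Sum>w\<in>Poly_Mapping.keys f. t ^ length (letters w) * ?X w $ p $ q) = 0"
      by (simp only: sum_component smult_matrix_nth)
  qed simp
  thus ?thesis by (simp only: vec_eq_iff sum_component zero_index) simp
qed

text \<open>At the zero matrices only the constant term survives, and the identity matrix has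
  nonzero trace in characteristic zero.\<close>

lemma constant_term_eq_0:
  fixes f :: "'a::field_char_0 ncpoly"
  assumes tr: "\<And>a :: nat \<Rightarrow> 'a^'n::finite^'n. trace (eval_ncpoly a f) = 0"
  shows "Poly_Mapping.lookup f (Word []) = 0"
proof -
  let ?a = "\<lambda>_. 0 :: 'a^'n^'n"
  have "eval_word ?a w = (if w = Word [] then mat 1 else 0)" for w
    by (cases w rule: nc_word.exhaust; case_tac x) simp_all
  hence "eval_ncpoly ?a f = (\<Sum>w\<in>Poly_Mapping.keys f. if w = Word [] then smult_matrix (Poly_Mapping.lookup f w) (mat 1) else 0)"
    unfolding eval_ncpoly_def by (intro sum.cong) auto
  also have "\<dots> = smult_matrix (Poly_Mapping.lookup f (Word [])) (mat 1)"
    by (auto simp: in_keys_iff)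
  finally have "trace (smult_matrix (Poly_Mapping.lookup f (Word [])) (mat 1 :: 'a^'n^'n)) = 0"
    using tr[of ?a] by simp
  thus ?thesis by (simp add: trace_smult trace_I)
qed

section \<open>Sums of commutators in the free algebra\<close>

definition commutator_sum :: "'a::ring_1 ncpoly \<Rightarrow> bool" where
  "commutator_sum h \<longleftrightarrow> (\<exists>pqs. h = (\<Sum>(p, q)\<leftarrow>pqs. p * q - q * p))"

lemma commutator_sum_commutator: "commutator_sum (p * q - q * p)"
  unfolding commutator_sum_def by (rule exI[of _ "[(p, q)]"]) simp

lemma commutator_sum_sum:
  assumes "\<And>i. i \<in> I \<Longrightarrow> commutator_sum (h i)"
  shows "commutator_sum (\<Sum>i\<in>I. h i)"
proof -
  have 0: "commutator_sum 0" unfolding commutator_sum_def by (rule exI[of _ "[]"]) simp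
  have add: "commutator_sum (g + h)" if gh: "commutator_sum g" "commutator_sum h" for g h
  proof -
    from gh obtain ps qs where "g = (\<Sum>(p, q)\<leftarrow>ps. p * q - q * p)" "h = (\<Sum>(p, q)\<leftarrow>qs. p * q - q * p)"
      unfolding commutator_sum_def by blast
    hence "g + h = (\<Sum>(p, q)\<leftarrow>ps @ qs. p * q - q * p)" by simp
    thus ?thesis unfolding commutator_sum_def by blast
  qed
  show ?thesis using assms by (induction I rule: infinite_finite_induct) (auto simp: 0 add)
qed

text \<open>If \<open>w\<close> is \<open>u v\<close>, its rotation is \<open>v u\<close>, and the
  difference is the commutator of \<open>u\<close> and \<open>v\<close>.\<close>

lemma commutator_sum_cycle_word:
  "commutator_sum (Poly_Mapping.single (Word w) c - Poly_Mapping.single (Word (cycle_word k w)) c)"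
proof -
  have "Poly_Mapping.single (Word w) c - Poly_Mapping.single (Word (cycle_word k w)) c =
    Poly_Mapping.single (Word (take (Suc k) w)) c * Poly_Mapping.single (Word (drop (Suc k) w)) 1 -
    Poly_Mapping.single (Word (drop (Suc k) w)) 1 * Poly_Mapping.single (Word (take (Suc k) w)) c"
    by (simp add: Poly_Mapping.mult_single plus_nc_word_def cycle_word_def)
  thus ?thesis by (simp add: commutator_sum_commutator)
qed

lemma trace_zero_cyclically_equivalent_identity:
  fixes f :: "'a::field_char_0 ncpoly"
  assumes tr: "\<And>a :: nat \<Rightarrow> 'a^'n::finite^'n. trace (eval_ncpoly a f) = 0"
  shows "\<exists>g. matrix_identity TYPE('n) g \<and> cyclically_equivalent f g"
proof -
  let ?K = "Poly_Mapping.keys f" and ?c = "Poly_Mapping.lookup f" and ?n = "\<lambda>w. length (letters w)"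
  define g where "g = (\<Sum>w\<in>?K. \<Sum>k<?n w.
    Poly_Mapping.single (Word (cycle_word k (letters w))) (?c w / of_nat (?n w)))"
  have "eval_ncpoly a g = 0" for a :: "nat \<Rightarrow> 'a^'n^'n"
  proof -
    let ?X = "\<lambda>w. smult_matrix (?c w) (\<Sum>k<?n w. eval_word a (Word (cycle_word k (letters w))))"
    have "eval_ncpoly a g = (\<Sum>w\<in>?K. smult_matrix (1 / of_nat (?n w)) (?X w))"
      by (simp add: g_def eval_ncpoly_sum smult_matrix_sum)
    \<comment> \<open>Grouping by length lets the factor \<open>1 / of_nat d\<close> be pulled out
      of each homogeneous part.\<close>
    also have "\<dots> = (\<Sum>d\<in>?n ` ?K. \<Sum>w\<in>{w\<in>?K. ?n w = d}. smult_matrix (1 / of_nat (?n w)) (?X w))"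
      by (rule sum.image_gen) simp
    also have "\<dots> = (\<Sum>d\<in>?n ` ?K. smult_matrix (1 / of_nat d) (\<Sum>w\<in>{w\<in>?K. ?n w = d}. ?X w))"
      by (intro sum.cong) (simp_all add: smult_matrix_sum[of _ _ "{w \<in> _. _ w}"])
    also have "\<dots> = 0" unfolding cycle_sum_homogeneous_eq_0[OF tr] by simp
    finally show ?thesis .
  qed
  hence "matrix_identity TYPE('n) g" by (auto simp: matrix_identity_def nc_image_def)
  moreover have "cyclically_equivalent f g"
  proof -
    \<comment> \<open>The empty word contributes nothing to \<open>g\<close>, so it must not occur
      in \<open>f\<close>.\<close>
    have pos: "?n w > 0" if "w \<in> ?K" for w
      using that constant_term_eq_0[OF tr] by (cases w) (auto simp: in_keys_iff)
    have "f = (\<Sum>w\<in>?K. Poly_Mapping.single w (?c w))"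
      by (rule poly_mapping_eqI) (simp add: lookup_sum lookup_single when_def in_keys_iff)
    also have "\<dots> = (\<Sum>w\<in>?K. \<Sum>k<?n w. Poly_Mapping.single (Word (letters w)) (?c w / of_nat (?n w)))"
    proof (rule sum.cong)
      fix w assume "w \<in> ?K"
      from pos[OF this] show "Poly_Mapping.single w (?c w) =
          (\<Sum>k<?n w. Poly_Mapping.single (Word (letters w)) (?c w / of_nat (?n w)))"
        by (intro poly_mapping_eqI) (simp only: lookup_sum lookup_single, auto simp: when_def)
    qed simp
    finally have "f - g = (\<Sum>w\<in>?K. \<Sum>k<?n w. Poly_Mapping.single (Word (letters w)) (?c w / of_nat (?n w))) - g"
      by (rule arg_cong[of _ _ "\<lambda>h. h - g"])
    also have "\<dots> = (\<Sum>w\<in>?K. \<Sum>k<?n w. Poly_Mapping.single (Word (letters w)) (?c w / of_nat (?n w)) -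
        Poly_Mapping.single (Word (cycle_word k (letters w))) (?c w / of_nat (?n w)))"
      by (simp only: g_def sum_subtractf)
    finally have "commutator_sum (f - g)"
      by (simp only:) (intro commutator_sum_sum commutator_sum_cycle_word)
    thus ?thesis by (simp add: commutator_sum_def cyclically_equivalent_def)
  qed
  ultimately show ?thesis by blast
qed

section \<open>Primitive roots of unity\<close>

text \<open>A root of \<open>1 + x + ... + x ^ (p - 1)\<close> is a \<open>p\<close>-th root of
  unity; it differs from 1 because \<open>p\<close> is nonzero in characteristic zero. Bezout then
  shows that its order is \<open>p\<close>.\<close>

lemma prime_order_root_of_unity:
  assumes "prime p"
  shows "\<exists>\<eta> :: 'a::{alg_closed_field, field_char_0}. \<forall>e. \<eta> ^ e = 1 \<longleftrightarrow> p dvd e"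
proof -
  have p: "p > 1" using assms by (rule prime_gt_1_nat)
  obtain \<eta> :: 'a where "(\<Sum>k\<le>p-1. 1 * \<eta> ^ k) = 0"
    using alg_closed[of "p - 1" "\<lambda>_. 1 :: 'a"] p by auto
  moreover have "{..p - 1} = {..<p}" using p by auto
  ultimately have sum0: "(\<Sum>k<p. \<eta> ^ k) = 0" by simp
  have "\<eta> \<noteq> 1" using sum0 p by auto
  have "\<eta> ^ p = 1" using power_diff_1_eq[of \<eta> p] sum0 by simp
  have "p dvd e" if "\<eta> ^ e = 1" for e
  proof (rule ccontr)
    assume "\<not> p dvd e"
    hence "gcd e p = 1" "e \<noteq> 0"
      using prime_imp_coprime[OF assms, of e] by (auto simp: coprime_iff_gcd_eq_1 gcd.commute intro!: gr0I)
    then obtain x y where xy: "e * x = p * y + 1" using bezout_nat[of e p] by auto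
    have "1 = \<eta> ^ (e * x)" by (simp add: power_mult that)
    also have "\<dots> = \<eta>" unfolding xy by (simp add: power_add power_mult \<open>\<eta> ^ p = 1\<close>)
    finally show False using \<open>\<eta> \<noteq> 1\<close> by simp
  qed
  moreover have "\<eta> ^ e = 1" if "p dvd e" for e
    using that \<open>\<eta> ^ p = 1\<close> by (auto simp: dvd_def power_mult)
  ultimately show ?thesis by blast
qed

text \<open>Write \<open>n = p * m\<close> and take a primitive \<open>m\<close>-th root of unity.
  If \<open>p\<close> divides \<open>m\<close>, a \<open>p\<close>-th root of it works; otherwise it
  is multiplied by an element of order \<open>p\<close>.\<close>

lemma primitive_root_of_unity:
  assumes "n > 0"
  shows "\<exists>\<omega> :: 'a::{alg_closed_field, field_char_0}. \<forall>d. \<omega> ^ d = 1 \<longleftrightarrow> n dvd d"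
  using assms
proof (induction n rule: less_induct)
  case (less n)
  show ?case
  proof (cases "n = 1")
    case True
    thus ?thesis by (intro exI[of _ 1]) simp
  next
    case False
    then obtain p where p: "prime p" "p dvd n" using prime_factor_nat by blast
    then obtain m where n: "n = p * m" by blast
    have "m < n" "m > 0" using n less.prems prime_gt_1_nat[OF p(1)] by auto
    from less.IH[OF this] obtain \<zeta> :: 'a where \<zeta>: "\<And>d. \<zeta> ^ d = 1 \<longleftrightarrow> m dvd d" by blast
    have p0: "p > 0" using prime_gt_1_nat[OF p(1)] by simp
    show ?thesis
    proof (cases "p dvd m")
      case True
      obtain \<omega> where \<omega>: "\<omega> ^ p = \<zeta>" using nth_root_exists[OF p0] by blast
      have "\<omega> ^ d = 1 \<longleftrightarrow> n dvd d" for d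
      proof
        assume d: "\<omega> ^ d = 1"
        have "\<zeta> ^ d = (\<omega> ^ d) ^ p" unfolding \<omega>[symmetric] by (simp add: power_mult[symmetric] mult.commute)
        hence "m dvd d" using d \<zeta> by simp
        with True obtain e where e: "d = p * e" by (meson dvd_trans dvdE)
        with d \<omega> have "\<zeta> ^ e = 1" by (simp add: power_mult)
        thus "n dvd d" using \<zeta> e n by simp
      next
        assume "n dvd d"
        then obtain e where "d = n * e" by (rule dvdE)
        hence "d = p * (m * e)" using n by simp
        hence "\<omega> ^ d = \<zeta> ^ (m * e)" using \<omega> by (simp add: power_mult)
        thus "\<omega> ^ d = 1" using \<zeta> by simp
      qed
      thus ?thesis by blast
    next
      case False
      obtain \<eta> :: 'a where \<eta>: "\<And>e. \<eta> ^ e = 1 \<longleftrightarrow> p dvd e"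
        using prime_order_root_of_unity[OF p(1)] by blast
      have "(\<zeta> * \<eta>) ^ d = 1 \<longleftrightarrow> n dvd d" for d
      proof
        assume d: "(\<zeta> * \<eta>) ^ d = 1"
        have "\<eta> ^ (d * m) = \<zeta> ^ (m * d) * \<eta> ^ (d * m)" using \<zeta>[of "m * d"] by simp
        also have "\<dots> = ((\<zeta> * \<eta>) ^ d) ^ m"
          by (simp add: power_mult_distrib power_mult[symmetric] mult.commute)
        also have "\<dots> = 1" using d by simp
        finally have "p dvd d * m" using \<eta> by simp
        hence pd: "p dvd d" using False p(1) by (simp add: prime_dvd_mult_iff)
        hence "\<eta> ^ d = 1" using \<eta> by simp
        hence "\<zeta> ^ d = 1" using d by (simp add: power_mult_distrib)
        hence "m dvd d" using \<zeta> by simp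
        moreover have "coprime p m" using False p(1) by (simp add: prime_imp_coprime)
        ultimately show "n dvd d" unfolding n using pd by (simp add: divides_mult)
      next
        assume "n dvd d"
        hence "p dvd d" "m dvd d" using n by auto
        hence "\<zeta> ^ d = 1" "\<eta> ^ d = 1" using \<zeta> \<eta> by simp_all
        thus "(\<zeta> * \<eta>) ^ d = 1" by (simp add: power_mult_distrib)
      qed
      thus ?thesis by blast
    qed
  qed
qed

section \<open>Clock and shift matrices\<close>

lemma mod_add_left_cancel:
  fixes m :: nat
  assumes "(m + l') mod N = (m + l) mod N" "m < N" "l < N" "l' < N"
  shows "l' = l"
proof -
  have "(m + l' + (N - m)) mod N = (m + l + (N - m)) mod N"
    using assms(1) by (metis mod_add_left_eq)
  moreover have "m + l' + (N - m) = l' + N" "m + l + (N - m) = l + N" using assms by simp_all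
  ultimately show ?thesis using assms by simp
qed

text \<open>The bijection \<open>\<phi>\<close> identifies the index type with the residues modulo
  \<open>CARD('n)\<close>, and \<open>\<omega>\<close> is a primitive root of unity of that
  order.\<close>

locale clock_shift =
  fixes \<phi> :: "'n::finite \<Rightarrow> nat" and \<omega> :: "'a::{alg_closed_field, field_char_0}"
  assumes bij_\<phi>: "bij_betw \<phi> UNIV {0..<CARD('n)}"
    and \<omega>: "\<And>d. \<omega> ^ d = 1 \<longleftrightarrow> CARD('n) dvd d"
begin

definition shift :: "nat \<Rightarrow> 'n \<Rightarrow> 'n" where
  "shift l q = inv \<phi> ((\<phi> q + l) mod CARD('n))"

text \<open>The \<open>l\<close>-th power of the shift times the \<open>k\<close>-th power of the
  clock matrix: the vector at \<open>q\<close> goes to \<open>\<omega> ^ (k * \<phi> q)\<close>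
  times the vector at \<open>shift l q\<close>.\<close>

definition X :: "nat \<Rightarrow> nat \<Rightarrow> 'a^'n^'n" where
  "X k l = (\<chi> p q. if p = shift l q then \<omega> ^ (k * \<phi> q) else 0)"

lemma inj_\<phi>: "inj \<phi>" and \<phi>_less: "\<phi> q < CARD('n)" and range_\<phi>: "range \<phi> = {0..<CARD('n)}"
  using bij_\<phi> by (auto simp: bij_betw_def)

lemma \<phi>_shift: "\<phi> (shift l q) = (\<phi> q + l) mod CARD('n)"
proof -
  have "(\<phi> q + l) mod CARD('n) \<in> range \<phi>" unfolding range_\<phi> by simp
  thus ?thesis unfolding shift_def by (rule f_inv_into_f)
qed

lemma shift_shift: "shift l (shift l' q) = shift (l' + l) q"
  using inj_\<phi> by (rule injD) (simp add: \<phi>_shift mod_add_left_eq add.assoc)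

lemma shift_eq_self: "shift l q = q \<longleftrightarrow> CARD('n) dvd l"
proof -
  have "shift l q = q \<longleftrightarrow> (\<phi> q + l) mod CARD('n) = \<phi> q mod CARD('n)"
    using inj_\<phi> \<phi>_less[of q] by (metis \<phi>_shift injD mod_less)
  also have "\<dots> \<longleftrightarrow> CARD('n) dvd l"
    using mod_eq_dvd_iff_nat[of "\<phi> q" "\<phi> q + l" "CARD('n)"] by simp
  finally show ?thesis .
qed

lemma inj_shift: "inj (shift l)"
proof (rule injI)
  fix p q assume "shift l p = shift l q"
  \<comment> \<open>This natural number stands in for the shift by minus \<open>l\<close>.\<close>
  hence "shift (CARD('n) * l - l) (shift l p) = shift (CARD('n) * l - l) (shift l q)" by simp
  moreover have "l \<le> CARD('n) * l" by simp
  ultimately have "shift (CARD('n) * l) p = shift (CARD('n) * l) q"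
    by (simp add: shift_shift)
  moreover have "shift (CARD('n) * l) r = r" for r by (simp add: shift_eq_self)
  ultimately show "p = q" by simp
qed

lemma \<omega>_mod: "\<omega> ^ (k * (m mod CARD('n))) = \<omega> ^ (k * m)"
proof -
  have "\<omega> ^ (k * m) = \<omega> ^ (CARD('n) * (k * (m div CARD('n))) + k * (m mod CARD('n)))"
    by (rule arg_cong[of _ _ "\<lambda>e. \<omega> ^ e"])
      (metis distrib_left mult.left_commute mult_div_mod_eq)
  also have "\<dots> = \<omega> ^ (k * (m mod CARD('n)))"
    using \<omega>[of "CARD('n) * (k * (m div CARD('n)))"] by (simp add: power_add)
  finally show ?thesis by simp
qed

lemma \<omega>_nonzero: "\<omega> \<noteq> 0"
  using \<omega>[of "CARD('n)"] by (auto simp: power_0_left)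

lemma X_mult: "X k l ** X k' l' = smult_matrix (\<omega> ^ (k * l')) (X (k + k') (l + l'))"
proof -
  have "(X k l ** X k' l') $ p $ q = \<omega> ^ (k * l') * X (k + k') (l + l') $ p $ q" for p q
  proof -
    have "(X k l ** X k' l') $ p $ q = X k l $ p $ shift l' q * \<omega> ^ (k' * \<phi> q)"
      by (simp add: matrix_matrix_mult_def X_def[of k' l'] if_distrib[of "\<lambda>u. _ * u"] cong: if_cong)
    also have "\<dots> = \<omega> ^ (k * l') * X (k + k') (l + l') $ p $ q"
      by (simp add: X_def shift_shift \<phi>_shift \<omega>_mod power_add algebra_simps)
    finally show ?thesis .
  qed
  thus ?thesis by (simp add: vec_eq_iff)
qed

lemma X_central: "CARD('n) dvd k \<Longrightarrow> CARD('n) dvd l \<Longrightarrow> X k l = mat 1"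
  using \<omega> by (auto simp: vec_eq_iff X_def mat_def shift_eq_self[THEN iffD2])

text \<open>Discrete Fourier inversion on each cyclic diagonal: for fixed \<open>l\<close> the
  matrices \<open>X k l\<close> carry the characters of the residues along the diagonal
  \<open>l\<close>.\<close>

lemma X_span: "\<exists>\<beta>. B = (\<Sum>x\<in>{..<CARD('n)} \<times> {..<CARD('n)}. smult_matrix (\<beta> x) (X (fst x) (snd x)))"
proof -
  let ?N = "CARD('n)"
  \<comment> \<open>The Fourier coefficients; the factor \<open>?N - 1\<close> replaces the exponent
    -1, as \<open>\<omega>\<close> has order \<open>?N\<close>.\<close>
  define \<beta> where "\<beta> x = 1 / of_nat ?N * (\<Sum>r\<in>UNIV. B $ shift (snd x) r $ r * \<omega> ^ ((?N - 1) * fst x * \<phi> r))" for x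
  have orth: "(\<Sum>k<?N. (\<omega> ^ (\<phi> q + (?N - 1) * \<phi> r)) ^ k) = (if q = r then of_nat ?N else 0)" for q r
  proof -
    let ?z = "\<omega> ^ (\<phi> q + (?N - 1) * \<phi> r)"
    have "?z = 1 \<longleftrightarrow> q = r"
    proof -
      have "?z * \<omega> ^ \<phi> r = \<omega> ^ (\<phi> q + ((?N - 1) * \<phi> r + \<phi> r))" by (simp add: power_add)
      also have "(?N - 1) * \<phi> r + \<phi> r = ?N * \<phi> r"
        using distrib_right[of "?N - 1" 1 "\<phi> r"] by simp
      also have "\<omega> ^ (\<phi> q + ?N * \<phi> r) = \<omega> ^ \<phi> q" using \<omega>[of "?N * \<phi> r"] by (simp add: power_add)
      finally have z: "?z * \<omega> ^ \<phi> r = \<omega> ^ \<phi> q" .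
      have inj: "q = r" if "\<phi> r \<le> \<phi> q" "\<omega> ^ \<phi> r = \<omega> ^ \<phi> q" for q r
      proof -
        have "\<omega> ^ \<phi> q = \<omega> ^ (\<phi> q - \<phi> r) * \<omega> ^ \<phi> r" using that(1) by (metis le_add_diff_inverse2 power_add)
        with that \<omega>_nonzero have "\<omega> ^ (\<phi> q - \<phi> r) = 1" by simp
        hence "?N dvd \<phi> q - \<phi> r" using \<omega> by simp
        hence "\<phi> q - \<phi> r = 0" using \<phi>_less[of q] by (metis dvd_imp_le less_imp_diff_less not_le not_gr_zero)
        with that show ?thesis using inj_\<phi> by (auto dest: injD)
      qed
      have "?z = 1 \<longleftrightarrow> \<omega> ^ \<phi> r = \<omega> ^ \<phi> q"
        using z \<omega>_nonzero by (metis mult_1 mult_cancel_right power_not_zero)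
      also have "\<dots> \<longleftrightarrow> q = r" using inj[of r q] inj[of q r] by (metis nat_le_linear)
      finally show ?thesis .
    qed
    moreover have "?z ^ ?N = 1"
      using \<omega>[of "(\<phi> q + (?N - 1) * \<phi> r) * ?N"] by (simp add: power_mult)
    hence "(?z - 1) * (\<Sum>k<?N. ?z ^ k) = 0"
      using power_diff_1_eq[of ?z ?N] by simp
    ultimately show ?thesis by auto
  qed
  have "B $ p $ q = (\<Sum>x\<in>{..<?N} \<times> {..<?N}. \<beta> x * X (fst x) (snd x) $ p $ q)" for p q
  proof -
    obtain l where l: "l < ?N" "p = shift l q" "\<And>l'. l' < ?N \<Longrightarrow> p = shift l' q \<longleftrightarrow> l' = l"
    proof -
      define l where "l = (\<phi> p + (?N - \<phi> q)) mod ?N"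
      have "\<phi> (shift l q) = (\<phi> p + ?N) mod ?N"
        using \<phi>_less[of q] by (simp add: \<phi>_shift l_def mod_add_right_eq)
      hence "\<phi> (shift l q) = \<phi> p" using \<phi>_less[of p] by simp
      hence p: "p = shift l q" using inj_\<phi> by (auto dest: injD)
      moreover have "l' = l" if "l' < ?N" "p = shift l' q" for l'
      proof -
        have "(\<phi> q + l') mod ?N = (\<phi> q + l) mod ?N"
          using that p by (metis \<phi>_shift)
        moreover have "l < ?N" by (simp add: l_def)
        ultimately show ?thesis using mod_add_left_cancel \<phi>_less that(1) by metis
      qed
      moreover have "l < ?N" by (simp add: l_def)
      ultimately show ?thesis using that[of l] by blast
    qed
    have "(\<Sum>x\<in>{..<?N} \<times> {..<?N}. \<beta> x * X (fst x) (snd x) $ p $ q) =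
        (\<Sum>k<?N. \<Sum>l'<?N. if l' = l then \<beta> (k, l') * \<omega> ^ (k * \<phi> q) else 0)"
      unfolding sum.cartesian_product' X_def by (intro sum.cong refl) (simp add: l(3))
    also have "\<dots> = (\<Sum>k<?N. \<beta> (k, l) * \<omega> ^ (k * \<phi> q))"
      using l(1) by simp
    also have "\<dots> = (\<Sum>k<?N. \<Sum>r\<in>UNIV. 1 / of_nat ?N * (B $ shift l r $ r * (\<omega> ^ (\<phi> q + (?N - 1) * \<phi> r)) ^ k))"
      by (simp add: \<beta>_def sum_distrib_left sum_distrib_right power_add power_mult_distrib mult_ac flip: power_mult)
    also have "\<dots> = (\<Sum>r\<in>UNIV. 1 / of_nat ?N * (B $ shift l r $ r * (\<Sum>k<?N. (\<omega> ^ (\<phi> q + (?N - 1) * \<phi> r)) ^ k)))"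
      by (subst sum.swap) (simp only: sum_distrib_left)
    also have "\<dots> = B $ p $ q"
      unfolding orth by (simp add: l(2) if_distrib cong: if_cong)
    finally show ?thesis by simp
  qed
  thus ?thesis by (intro exI[of _ \<beta>]) (simp add: vec_eq_iff)
qed

section \<open>Quantum torus families\<close>

text \<open>The exponents of the parameters are the indices of \<open>X\<close> themselves, not
  their residues. By \<open>X_mult\<close> they add under multiplication, so such families form an
  algebra.\<close>

definition torus :: "('a \<Rightarrow> 'a \<Rightarrow> 'a^'n^'n) \<Rightarrow> bool" where
  "torus \<Psi> \<longleftrightarrow> (\<exists>S b. finite S \<and> (\<forall>\<alpha> \<beta>. \<Psi> \<alpha> \<beta> =
    (\<Sum>x\<in>S. smult_matrix (b x * \<alpha> ^ fst x * \<beta> ^ snd x) (X (fst x) (snd x)))))"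

lemma torus_monomial: "torus (\<lambda>\<alpha> \<beta>. smult_matrix (c * \<alpha> ^ k * \<beta> ^ l) (X k l))"
  unfolding torus_def by (intro exI[of _ "{(k, l)}"] exI[of _ "\<lambda>_. c"]) simp

lemma torus_0: "torus (\<lambda>_ _. 0)"
  unfolding torus_def by (rule exI[of _ "{}"]) simp

lemma torus_add:
  assumes "torus \<Psi>" "torus \<Psi>'"
  shows "torus (\<lambda>\<alpha> \<beta>. \<Psi> \<alpha> \<beta> + \<Psi>' \<alpha> \<beta>)"
proof -
  from assms obtain S b S' b' where *: "finite S" "finite S'"
    "\<And>\<alpha> \<beta>. \<Psi> \<alpha> \<beta> = (\<Sum>x\<in>S. smult_matrix (b x * \<alpha> ^ fst x * \<beta> ^ snd x) (X (fst x) (snd x)))"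
    "\<And>\<alpha> \<beta>. \<Psi>' \<alpha> \<beta> = (\<Sum>x\<in>S'. smult_matrix (b' x * \<alpha> ^ fst x * \<beta> ^ snd x) (X (fst x) (snd x)))"
    unfolding torus_def by blast
  have ext: "(\<Sum>x\<in>T. smult_matrix (c x * \<alpha> ^ fst x * \<beta> ^ snd x) (X (fst x) (snd x))) =
      (\<Sum>x\<in>S \<union> S'. smult_matrix ((if x \<in> T then c x else 0) * \<alpha> ^ fst x * \<beta> ^ snd x) (X (fst x) (snd x)))"
    if "T \<subseteq> S \<union> S'" for T c \<alpha> \<beta>
    using that *(1,2) by (intro sum.mono_neutral_cong_left) auto
  have "\<Psi> \<alpha> \<beta> + \<Psi>' \<alpha> \<beta> = (\<Sum>x\<in>S \<union> S'. smult_matrix (((if x \<in> S then b x else 0) + (if x \<in> S' then b' x else 0)) *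
      \<alpha> ^ fst x * \<beta> ^ snd x) (X (fst x) (snd x)))" for \<alpha> \<beta>
    unfolding *(3,4) by (subst (1 2) ext) (simp_all add: sum.distrib[symmetric] smult_matrix_add_left[symmetric] distrib_right)
  thus ?thesis using *(1,2) unfolding torus_def
    by (intro exI[of _ "S \<union> S'"] exI[of _ "\<lambda>x. (if x \<in> S then b x else 0) + (if x \<in> S' then b' x else 0)"]) simp
qed

lemma torus_sum:
  assumes "\<And>i. i \<in> I \<Longrightarrow> torus (\<Psi> i)"
  shows "torus (\<lambda>\<alpha> \<beta>. \<Sum>i\<in>I. \<Psi> i \<alpha> \<beta>)"
  using assms by (induction I rule: infinite_finite_induct) (auto intro: torus_0 torus_add)

lemma torus_mult:
  assumes "torus \<Psi>" "torus \<Psi>'"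
  shows "torus (\<lambda>\<alpha> \<beta>. \<Psi> \<alpha> \<beta> ** \<Psi>' \<alpha> \<beta>)"
proof -
  from assms obtain S b S' b' where *: "finite S" "finite S'"
    "\<And>\<alpha> \<beta>. \<Psi> \<alpha> \<beta> = (\<Sum>x\<in>S. smult_matrix (b x * \<alpha> ^ fst x * \<beta> ^ snd x) (X (fst x) (snd x)))"
    "\<And>\<alpha> \<beta>. \<Psi>' \<alpha> \<beta> = (\<Sum>x\<in>S'. smult_matrix (b' x * \<alpha> ^ fst x * \<beta> ^ snd x) (X (fst x) (snd x)))"
    unfolding torus_def by blast
  have "\<Psi> \<alpha> \<beta> ** \<Psi>' \<alpha> \<beta> = (\<Sum>x\<in>S. \<Sum>y\<in>S'. smult_matrix ((b x * b' y * \<omega> ^ (fst x * snd y)) *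
      \<alpha> ^ (fst x + fst y) * \<beta> ^ (snd x + snd y)) (X (fst x + fst y) (snd x + snd y)))" for \<alpha> \<beta>
    unfolding *(3,4) matrix_mult_sum_left unfolding matrix_mult_sum_right
    by (intro sum.cong) (simp_all add: smult_matrix_mult_left smult_matrix_mult_right X_mult power_add mult_ac)
  thus ?thesis by (simp only:) (intro torus_sum torus_monomial)
qed

lemma torus_smult:
  assumes "torus \<Psi>"
  shows "torus (\<lambda>\<alpha> \<beta>. smult_matrix c (\<Psi> \<alpha> \<beta>))"
proof -
  from assms obtain S b where "finite S"
    "\<And>\<alpha> \<beta>. \<Psi> \<alpha> \<beta> = (\<Sum>x\<in>S. smult_matrix (b x * \<alpha> ^ fst x * \<beta> ^ snd x) (X (fst x) (snd x)))"
    unfolding torus_def by blast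
  hence "smult_matrix c (\<Psi> \<alpha> \<beta>) = (\<Sum>x\<in>S. smult_matrix ((c * b x) * \<alpha> ^ fst x * \<beta> ^ snd x) (X (fst x) (snd x)))" for \<alpha> \<beta>
    by (simp add: smult_matrix_sum mult.assoc)
  thus ?thesis by (simp only:) (intro torus_sum torus_monomial)
qed

lemma torus_eval_ncpoly:
  assumes "\<And>i. torus (\<lambda>\<alpha> \<beta>. a \<alpha> \<beta> i)"
  shows "torus (\<lambda>\<alpha> \<beta>. eval_ncpoly (a \<alpha> \<beta>) f)"
proof -
  have 1: "torus (\<lambda>_ _. mat 1)"
    using torus_monomial[of 1 0 0] by (simp add: X_central)
  have "torus (\<lambda>\<alpha> \<beta>. eval_word (a \<alpha> \<beta>) (Word w))" for w
    by (induction w) (simp_all add: 1 torus_mult assms)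
  from this[of "letters _"] show ?thesis
    unfolding eval_ncpoly_def by (intro torus_sum torus_smult) simp
qed

end

section \<open>A value far from the scalar matrices\<close>

text \<open>For \<open>A\<close> of maximal size, any index outside \<open>A\<close>, its image and
  its preimage could still be added. So these three sets, none larger than \<open>A\<close>, cover
  everything.\<close>

lemma fixpoint_free_disjoint_image:
  fixes \<sigma> :: "'n::finite \<Rightarrow> 'n"
  assumes inj: "inj \<sigma>" and free: "\<And>q. \<sigma> q \<noteq> q"
  shows "\<exists>A. \<sigma> ` A \<inter> A = {} \<and> CARD('n) \<le> 3 * card A"
proof -
  have "\<exists>A. \<sigma> ` A \<inter> A = {} \<and> (\<forall>B. \<sigma> ` B \<inter> B = {} \<longrightarrow> card B \<le> card A)"
    by (rule ex_has_greatest_nat[of "\<lambda>A. \<sigma> ` A \<inter> A = {}" "{}" card "Suc CARD('n)"])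
      (simp_all add: card_mono less_Suc_eq_le)
  then obtain A where A: "\<sigma> ` A \<inter> A = {}" and max: "\<forall>B. \<sigma> ` B \<inter> B = {} \<longrightarrow> card B \<le> card A"
    by (elim exE conjE)
  have "UNIV \<subseteq> (A \<union> \<sigma> ` A) \<union> \<sigma> -` A"
  proof
    fix y
    show "y \<in> (A \<union> \<sigma> ` A) \<union> \<sigma> -` A"
    proof (rule ccontr)
      assume y: "\<not> ?thesis"
      hence "\<sigma> ` insert y A \<inter> insert y A = {}" using A free[of y] by auto
      with max have "card (insert y A) \<le> card A" by blast
      with y show False by simp
    qed
  qed
  hence "CARD('n) \<le> card ((A \<union> \<sigma> ` A) \<union> \<sigma> -` A)" by (simp add: card_mono)
  also have "\<dots> \<le> card A + card (\<sigma> ` A) + card (\<sigma> -` A)"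
    by (rule order_trans[OF card_Un_le]) (simp add: card_Un_le)
  also have "\<dots> \<le> 3 * card A"
    using card_image_le[of A \<sigma>] card_vimage_inj_on_le[of \<sigma> UNIV A] inj by simp
  finally show ?thesis using A by blast
qed

text \<open>Column \<open>\<sigma> a\<close> is \<open>B\<close> applied to column \<open>a\<close>.
  When this matrix is invertible, its columns form a basis in which \<open>B\<close> sends the basis
  vector at \<open>a\<close> to the one at \<open>\<sigma> a\<close>, for all \<open>a\<close> in
  \<open>A\<close>.\<close>

definition krylov_matrix :: "'n set \<Rightarrow> ('n \<Rightarrow> 'n) \<Rightarrow> ('n \<Rightarrow> 'a^'n) \<Rightarrow> 'a::comm_ring_1^'n::finite^'n \<Rightarrow> 'a^'n^'n" where
  "krylov_matrix A \<sigma> r B = (\<chi> p q. if q \<in> \<sigma> ` A then (B *v r (inv_into A \<sigma> q)) $ p else r q $ p)"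

text \<open>Up to ordering, the matrix is block diagonal: each pair \<open>a\<close>,
  \<open>\<sigma> a\<close> gives a 2 by 2 block with determinant
  \<open>mu a - \<epsilon> * lam a\<close>, and the remaining columns are unit vectors.\<close>

lemma det_krylov_matrix_nonzero:
  fixes B :: "'a::field^'n::finite^'n"
  assumes \<sigma>: "inj_on \<sigma> A" "\<sigma> ` A \<inter> A = {}"
    and r: "\<And>p q. r q $ p = (if p = q then 1 else if q \<in> A \<and> p = \<sigma> q then \<epsilon> else 0)"
    and B: "\<And>p a. a \<in> A \<Longrightarrow> (B *v r a) $ p = (if p = a then lam a else if p = \<sigma> a then mu a else 0)"
    and nz: "\<And>a. a \<in> A \<Longrightarrow> mu a \<noteq> \<epsilon> * lam a"
  shows "det (krylov_matrix A \<sigma> r B) \<noteq> 0"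
proof -
  let ?G = "krylov_matrix A \<sigma> r B"
  have \<sigma>A: "\<sigma> a \<notin> A" "a \<notin> \<sigma> ` A" if "a \<in> A" for a using that \<sigma> by blast+
  have "x = 0" if x: "?G *v x = 0" for x
  proof -
    have row: "0 = (\<Sum>q\<in>- \<sigma> ` A. r q $ p * x $ q) + (\<Sum>a\<in>A. (B *v r a) $ p * x $ \<sigma> a)" for p
    proof -
      have "0 = (\<Sum>q\<in>UNIV. ?G $ p $ q * x $ q)"
        using x by (simp add: vec_eq_iff matrix_vector_mult_def)
      also have "\<dots> = (\<Sum>q\<in>- \<sigma> ` A. ?G $ p $ q * x $ q) + (\<Sum>q\<in>\<sigma> ` A. ?G $ p $ q * x $ q)"
        by (subst sum.union_disjoint[symmetric]) (auto intro: sum.cong)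
      also have "(\<Sum>q\<in>- \<sigma> ` A. ?G $ p $ q * x $ q) = (\<Sum>q\<in>- \<sigma> ` A. r q $ p * x $ q)"
        by (intro sum.cong) (auto simp: krylov_matrix_def)
      also have "(\<Sum>q\<in>\<sigma> ` A. ?G $ p $ q * x $ q) = (\<Sum>a\<in>A. (B *v r a) $ p * x $ \<sigma> a)"
        using \<sigma>(1) by (simp add: sum.reindex krylov_matrix_def)
      finally show ?thesis .
    qed
    have 1: "x $ a + lam a * x $ \<sigma> a = 0" if a: "a \<in> A" for a
    proof -
      have "(\<Sum>q\<in>- \<sigma> ` A. r q $ a * x $ q) = (\<Sum>q\<in>- \<sigma> ` A. if q = a then x $ q else 0)"
        using \<sigma>A a by (intro sum.cong) (auto simp: r)
      moreover have "(\<Sum>b\<in>A. (B *v r b) $ a * x $ \<sigma> b) = (\<Sum>b\<in>A. if b = a then lam b * x $ \<sigma> b else 0)"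
        using \<sigma>A a by (intro sum.cong) (auto simp: B)
      ultimately show ?thesis using row[of a] a \<sigma>A[OF a] by simp
    qed
    have 2: "\<epsilon> * x $ a + mu a * x $ \<sigma> a = 0" if a: "a \<in> A" for a
    proof -
      have "(\<Sum>q\<in>- \<sigma> ` A. r q $ \<sigma> a * x $ q) = (\<Sum>q\<in>- \<sigma> ` A. if q = a then \<epsilon> * x $ q else 0)"
      proof (rule sum.cong)
        fix q assume "q \<in> - \<sigma> ` A"
        hence "\<sigma> a \<noteq> q" "q \<in> A \<and> \<sigma> a = \<sigma> q \<longleftrightarrow> q = a" using a inj_on_eq_iff[OF \<sigma>(1)] by blast+
        thus "r q $ \<sigma> a * x $ q = (if q = a then \<epsilon> * x $ q else 0)" by (simp add: r)
      qed simp
      moreover have "(\<Sum>b\<in>A. (B *v r b) $ \<sigma> a * x $ \<sigma> b) = (\<Sum>b\<in>A. if b = a then mu b * x $ \<sigma> b else 0)"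
      proof (rule sum.cong)
        fix b assume b: "b \<in> A"
        hence "\<sigma> a \<noteq> b" "\<sigma> a = \<sigma> b \<longleftrightarrow> b = a" using a \<sigma>A(1) inj_on_eq_iff[OF \<sigma>(1)] by blast+
        thus "(B *v r b) $ \<sigma> a * x $ \<sigma> b = (if b = a then mu b * x $ \<sigma> b else 0)" by (simp add: B b)
      qed simp
      ultimately show ?thesis using row[of "\<sigma> a"] a \<sigma>A[OF a] by simp
    qed
    have z: "x $ \<sigma> a = 0" "x $ a = 0" if a: "a \<in> A" for a
    proof -
      have "(mu a - \<epsilon> * lam a) * x $ \<sigma> a = (\<epsilon> * x $ a + mu a * x $ \<sigma> a) - \<epsilon> * (x $ a + lam a * x $ \<sigma> a)"
        by (simp add: algebra_simps)
      also have "\<dots> = 0" using 1[OF a] 2[OF a] by simp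
      finally show "x $ \<sigma> a = 0" using nz[OF a] by simp
      with 1[OF a] show "x $ a = 0" by simp
    qed
    have "x $ p = 0" for p
    proof (cases "p \<in> \<sigma> ` A \<or> p \<in> A")
      case True
      thus ?thesis using z by blast
    next
      case False
      have "(\<Sum>q\<in>- \<sigma> ` A. r q $ p * x $ q) = (\<Sum>q\<in>- \<sigma> ` A. if q = p then x $ q else 0)"
        using False by (intro sum.cong) (auto simp: r)
      moreover have "(\<Sum>a\<in>A. (B *v r a) $ p * x $ \<sigma> a) = 0"
        using z by (intro sum.neutral) simp
      ultimately show ?thesis using row[of p] False by simp
    qed
    thus ?thesis by (simp add: vec_eq_iff)
  qed
  hence "invertible ?G"
    unfolding invertible_left_inverse using matrix_left_invertible_ker by blast
  thus ?thesis by (simp add: invertible_det_nz)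
qed

context clock_shift
begin

text \<open>If \<open>l\<close> is not divisible by \<open>CARD('n)\<close>, the monomial moves
  every basis vector to a multiple of another one, so unit vectors suffice. Otherwise it is diagonal
  and cyclically adjacent entries differ by the factor \<open>\<omega> ^ k\<close>; sums of two
  adjacent basis vectors then work.\<close>

lemma monomial_krylov:
  assumes N: "CARD('n) \<ge> 2" and c: "c \<noteq> 0"
    and nc: "\<not> (CARD('n) dvd k \<and> CARD('n) dvd l)"
  shows "\<exists>A \<sigma> r. inj_on \<sigma> A \<and> \<sigma> ` A \<inter> A = {} \<and> CARD('n) \<le> 3 * card A \<and>
    det (krylov_matrix A \<sigma> r (smult_matrix c (X k l))) \<noteq> 0"
proof (cases "CARD('n) dvd l")
  case False
  hence sh: "shift l a \<noteq> a" for a by (simp add: shift_eq_self)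
  obtain A where A: "shift l ` A \<inter> A = {}" "CARD('n) \<le> 3 * card A"
    using fixpoint_free_disjoint_image[OF inj_shift sh] by blast
  have inj: "inj_on (shift l) A" using inj_shift by (rule inj_on_subset) simp
  have "det (krylov_matrix A (shift l) (\<lambda>q. axis q 1) (smult_matrix c (X k l))) \<noteq> 0"
  proof (rule det_krylov_matrix_nonzero[OF inj A(1), where \<epsilon> = 0 and lam = "\<lambda>_. 0" and mu = "\<lambda>a. c * \<omega> ^ (k * \<phi> a)"])
    fix p a
    have "(smult_matrix c (X k l) *v axis a 1) $ p = c * X k l $ p $ a"
      by (simp add: matrix_vector_mult_def axis_def if_distrib cong: if_cong)
    thus "(smult_matrix c (X k l) *v axis a 1) $ p =
        (if p = a then 0 else if p = shift l a then c * \<omega> ^ (k * \<phi> a) else 0)"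
      using sh[of a] by (auto simp: X_def)
  qed (use c \<omega>_nonzero in \<open>auto simp: axis_def\<close>)
  with inj A show ?thesis by blast
next
  case True
  with nc have k: "\<omega> ^ k \<noteq> 1" using \<omega> by simp
  have sh: "shift 1 q \<noteq> q" for q using N by (simp add: shift_eq_self)
  obtain A where A: "shift 1 ` A \<inter> A = {}" "CARD('n) \<le> 3 * card A"
    using fixpoint_free_disjoint_image[OF inj_shift sh] by blast
  have inj: "inj_on (shift 1) A" using inj_shift by (rule inj_on_subset) simp
  define r :: "'n \<Rightarrow> 'a^'n" where "r q = (\<chi> p. if p = q then 1 else if q \<in> A \<and> p = shift 1 q then 1 else 0)" for q
  define lam where "lam q = c * \<omega> ^ (k * \<phi> q)" for q
  have X: "(smult_matrix c (X k l) *v v) $ p = lam p * v $ p" for v p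
    using True by (simp add: matrix_vector_mult_def X_def shift_eq_self[THEN iffD2] if_distrib[of "\<lambda>u. u * _"] if_distrib[of "\<lambda>u. c * u"] lam_def cong: if_cong)
  have "det (krylov_matrix A (shift 1) r (smult_matrix c (X k l))) \<noteq> 0"
  proof (rule det_krylov_matrix_nonzero[OF inj A(1), where \<epsilon> = 1 and lam = lam and mu = "\<lambda>a. lam (shift 1 a)"])
    fix a
    have "lam (shift 1 a) = \<omega> ^ k * lam a"
      by (simp add: lam_def \<phi>_shift \<omega>_mod power_add algebra_simps)
    thus "lam (shift 1 a) \<noteq> 1 * lam a"
      using k c \<omega>_nonzero by (auto simp: lam_def)
  next
    fix p a assume "a \<in> A"
    thus "(smult_matrix c (X k l) *v r a) $ p = (if p = a then lam a else if p = shift 1 a then lam (shift 1 a) else 0)"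
      unfolding X by (simp add: r_def)
  qed (simp add: r_def)
  with inj A show ?thesis by blast
qed

text \<open>
  Restrict \<open>f\<close> to matrices \<open>\<Sum> \<beta>\<^sub>k\<^sub>l \<tau>\<^sup>k \<tau>\<^sup>Q\<^sup>l X k l\<close> with \<open>Q\<close> large. Up to scalar matrices its values are
  dominated, as \<open>\<tau>\<close> tends to \<open>0\<close>, by a single noncentral monomial \<open>X k l\<close>, which is far from
  scalar; the nonvanishing of \<open>det (krylov_matrix \<dots>)\<close> passes to generic \<open>\<tau>\<close>.
\<close>

lemma noncentral_value_far_from_scalars:
  fixes f :: "'a ncpoly" and a :: "nat \<Rightarrow> 'a^'n^'n"
  assumes N: "CARD('n) \<ge> 2" and nc: "eval_ncpoly a f \<notin> matrix_center"
  shows "\<exists>b\<in>nc_image f. \<exists>A \<sigma> s t. inj_on \<sigma> A \<and> \<sigma> ` A \<inter> A = {} \<and> CARD('n) \<le> 3 * card A \<and> t \<noteq> 0 \<and>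
    (\<forall>a\<in>A. \<forall>p. (b :: 'a^'n^'n) $ p $ a = (if p = a then s else if p = \<sigma> a then t else 0))"
proof -
  let ?N = "CARD('n)"
  have "\<forall>i. \<exists>\<beta>. a i = (\<Sum>x\<in>{..<?N} \<times> {..<?N}. smult_matrix (\<beta> x) (X (fst x) (snd x)))"
    using X_span by blast
  from choice[OF this] obtain g
    where g: "\<And>i. a i = (\<Sum>x\<in>{..<?N} \<times> {..<?N}. smult_matrix (g i x) (X (fst x) (snd x)))" by blast
  \<comment> \<open>At both parameters equal to 1 the substituted matrices are the given
    \<open>a i\<close>.\<close>
  define \<Psi> where "\<Psi> \<alpha> \<beta> = eval_ncpoly (\<lambda>i. \<Sum>x\<in>{..<?N} \<times> {..<?N}.
    smult_matrix (g i x * \<alpha> ^ fst x * \<beta> ^ snd x) (X (fst x) (snd x))) f" for \<alpha> \<beta>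
  have "torus \<Psi>" unfolding \<Psi>_def by (intro torus_eval_ncpoly torus_sum torus_monomial)
  then obtain S b where S: "finite S" and
    b: "\<And>\<alpha> \<beta>. \<Psi> \<alpha> \<beta> = (\<Sum>x\<in>S. smult_matrix (b x * \<alpha> ^ fst x * \<beta> ^ snd x) (X (fst x) (snd x)))"
    unfolding torus_def by blast
  have \<Psi>_image: "\<Psi> \<alpha> \<beta> \<in> nc_image f" for \<alpha> \<beta> by (simp add: \<Psi>_def nc_image_def)
  \<comment> \<open>The exponents in \<open>C\<close> give scalar matrices; \<open>S1\<close>
    collects the noncentral monomials that really occur.\<close>
  define C where "C = {x\<in>S. ?N dvd fst x \<and> ?N dvd snd x}"
  define S1 where "S1 = {x\<in>S. b x \<noteq> 0 \<and> \<not> (?N dvd fst x \<and> ?N dvd snd x)}"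
  have split: "\<Psi> \<alpha> \<beta> = smult_matrix (\<Sum>x\<in>C. b x * \<alpha> ^ fst x * \<beta> ^ snd x) (mat 1) +
      (\<Sum>x\<in>S1. smult_matrix (b x * \<alpha> ^ fst x * \<beta> ^ snd x) (X (fst x) (snd x)))" for \<alpha> \<beta>
  proof -
    have fin: "finite C" "finite (S - C)" using S by (auto simp: C_def)
    have "\<Psi> \<alpha> \<beta> = (\<Sum>x\<in>C. smult_matrix (b x * \<alpha> ^ fst x * \<beta> ^ snd x) (X (fst x) (snd x))) +
        (\<Sum>x\<in>S - C. smult_matrix (b x * \<alpha> ^ fst x * \<beta> ^ snd x) (X (fst x) (snd x)))"
      unfolding b using S by (subst add.commute, intro sum.subset_diff) (auto simp: C_def)
    also have "(\<Sum>x\<in>C. smult_matrix (b x * \<alpha> ^ fst x * \<beta> ^ snd x) (X (fst x) (snd x))) =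
        smult_matrix (\<Sum>x\<in>C. b x * \<alpha> ^ fst x * \<beta> ^ snd x) (mat 1)"
    proof -
      have "(\<Sum>x\<in>C. smult_matrix (b x * \<alpha> ^ fst x * \<beta> ^ snd x) (X (fst x) (snd x))) =
          (\<Sum>x\<in>C. smult_matrix (b x * \<alpha> ^ fst x * \<beta> ^ snd x) (mat 1))"
        by (intro sum.cong) (auto simp: C_def X_central)
      also have "\<dots> = smult_matrix (\<Sum>x\<in>C. b x * \<alpha> ^ fst x * \<beta> ^ snd x) (mat 1)"
        by (simp add: vec_eq_iff sum_distrib_right)
      finally show ?thesis .
    qed
    also have "(\<Sum>x\<in>S - C. smult_matrix (b x * \<alpha> ^ fst x * \<beta> ^ snd x) (X (fst x) (snd x))) =
        (\<Sum>x\<in>S1. smult_matrix (b x * \<alpha> ^ fst x * \<beta> ^ snd x) (X (fst x) (snd x)))"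
      using fin(2) by (intro sum.mono_neutral_right) (auto simp: C_def S1_def)
    finally show ?thesis .
  qed
  have "S1 \<noteq> {}"
  proof
    assume "S1 = {}"
    hence "\<Psi> 1 1 = smult_matrix (\<Sum>x\<in>C. b x) (mat 1)" using split[of 1 1] by simp
    moreover have "\<Psi> 1 1 = eval_ncpoly a f" by (simp add: \<Psi>_def g[symmetric])
    moreover have "smult_matrix c (mat 1) \<in> (matrix_center :: ('a^'n^'n) set)" for c
      by (simp add: matrix_center_def smult_matrix_mult_left smult_matrix_mult_right)
    ultimately show False using nc by metis
  qed
  obtain Q where Q: "\<And>x. x \<in> S \<Longrightarrow> fst x < Q"
  proof (rule that[of "Suc (Max (fst ` S))"])
    fix x assume "x \<in> S"
    thus "fst x < Suc (Max (fst ` S))" using S by (simp add: less_Suc_eq_le)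
  qed
  \<comment> \<open>The exponent of \<open>\<tau>\<close> after substituting \<open>\<tau>\<close>
    and \<open>\<tau> ^ Q\<close>. As \<open>Q\<close> exceeds all first exponents, different
    monomials get different weights.\<close>
  define wt where "wt x = fst x + Q * snd x" for x :: "nat \<times> nat"
  have wt_inj: "x = y" if "x \<in> S" "y \<in> S" "wt x = wt y" for x y
  proof -
    have Q0: "Q > 0" using Q[OF that(1)] by simp
    have "fst x = fst y" using arg_cong[OF that(3), of "\<lambda>k. k mod Q"] Q that by (simp add: wt_def)
    moreover have "snd x = snd y" using arg_cong[OF that(3), of "\<lambda>k. k div Q"] Q that Q0 by (simp add: wt_def)
    ultimately show ?thesis by (simp add: prod_eq_iff)
  qed
  have "\<exists>x0. x0 \<in> S1 \<and> (\<forall>x. x \<in> S1 \<longrightarrow> wt x0 \<le> wt x)"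
    using \<open>S1 \<noteq> {}\<close> ex_has_least_nat[of "\<lambda>x. x \<in> S1" _ wt] by blast
  then obtain x0 where x0: "x0 \<in> S1" "\<And>x. x \<in> S1 \<Longrightarrow> wt x0 \<le> wt x" by blast
  \<comment> \<open>The noncentral part divided by its lowest power of \<open>\<tau>\<close>; at
    \<open>\<tau> = 0\<close> only the monomial \<open>x0\<close> survives.\<close>
  define B where "B \<tau> = (\<Sum>x\<in>S1. smult_matrix (b x * \<tau> ^ (wt x - wt x0)) (X (fst x) (snd x)))" for \<tau>
  have B: "\<Psi> \<tau> (\<tau> ^ Q) = smult_matrix (\<Sum>x\<in>C. b x * \<tau> ^ fst x * (\<tau> ^ Q) ^ snd x) (mat 1) +
      smult_matrix (\<tau> ^ wt x0) (B \<tau>)" for \<tau>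
  proof -
    have "\<tau> ^ fst x * (\<tau> ^ Q) ^ snd x = \<tau> ^ wt x0 * \<tau> ^ (wt x - wt x0)" if "x \<in> S1" for x
      using x0(2)[OF that] by (simp add: wt_def flip: power_mult power_add)
    hence e: "b x * \<tau> ^ fst x * (\<tau> ^ Q) ^ snd x = \<tau> ^ wt x0 * (b x * \<tau> ^ (wt x - wt x0))" if "x \<in> S1" for x
      using that by (metis mult.assoc mult.left_commute)
    show ?thesis unfolding split B_def smult_matrix_sum smult_matrix_smult_matrix
      by (intro arg_cong2[of _ _ _ _ "(+)"] sum.cong refl) (simp only: e)
  qed
  have B0: "B 0 = smult_matrix (b x0) (X (fst x0) (snd x0))"
  proof -
    have "S1 \<subseteq> S" "finite S1" using S by (auto simp: S1_def)
    have "wt x - wt x0 \<noteq> 0" if "x \<in> S1" "x \<noteq> x0" for x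
      using x0 wt_inj[of x x0] that \<open>S1 \<subseteq> S\<close> by (metis diff_is_0_eq order_antisym subsetD)
    hence "B 0 = (\<Sum>x\<in>S1. if x = x0 then smult_matrix (b x) (X (fst x) (snd x)) else 0)"
      unfolding B_def by (intro sum.cong) (auto simp: power_0_left)
    also have "\<dots> = smult_matrix (b x0) (X (fst x0) (snd x0))"
      using \<open>finite S1\<close> x0(1) by simp
    finally show ?thesis .
  qed
  have B_poly: "poly_fun (\<lambda>\<tau>. B \<tau> $ p $ q)" for p q
    unfolding B_def sum_component smult_matrix_nth
    by (intro poly_fun_sum poly_fun_mult poly_fun_const poly_fun_power poly_fun_id)
  from x0(1) have "b x0 \<noteq> 0" "\<not> (?N dvd fst x0 \<and> ?N dvd snd x0)" by (auto simp: S1_def)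
  from monomial_krylov[OF N this] obtain A \<sigma> r where A: "inj_on \<sigma> A" "\<sigma> ` A \<inter> A = {}" "?N \<le> 3 * card A"
    and det0: "det (krylov_matrix A \<sigma> r (B 0)) \<noteq> 0"
    unfolding B0 by blast
  have "poly_fun (\<lambda>\<tau>. krylov_matrix A \<sigma> r (B \<tau>) $ p $ q)" for p q
  proof (cases "q \<in> \<sigma> ` A")
    case True
    hence "krylov_matrix A \<sigma> r (B \<tau>) $ p $ q = (\<Sum>i\<in>UNIV. B \<tau> $ p $ i * r (inv_into A \<sigma> q) $ i)" for \<tau>
      by (simp add: krylov_matrix_def matrix_vector_mult_def)
    thus ?thesis by (simp only:) (intro poly_fun_sum poly_fun_mult B_poly poly_fun_const)
  qed (simp add: krylov_matrix_def poly_fun_const)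
  \<comment> \<open>The parameter must be nonzero so that the factor \<open>\<tau> ^ wt x0\<close>,
    which becomes \<open>t\<close>, does not vanish.\<close>
  from poly_fun_nonzero[OF poly_fun_det[OF this] det0] obtain \<tau>
    where \<tau>: "\<tau> \<noteq> 0" "det (krylov_matrix A \<sigma> r (B \<tau>)) \<noteq> 0" by blast
  define G where "G = krylov_matrix A \<sigma> r (B \<tau>)"
  from \<tau>(2) have "invertible G" by (simp add: invertible_det_nz G_def)
  then obtain H where H: "G ** H = mat 1" "H ** G = mat 1" unfolding invertible_def by blast
  define V where "V = H ** \<Psi> \<tau> (\<tau> ^ Q) ** G"
  have "V \<in> nc_image f"
    unfolding V_def using \<Psi>_image
  proof (rule nc_image_similar)
    show "similar_matrix (H ** \<Psi> \<tau> (\<tau> ^ Q) ** G) (\<Psi> \<tau> (\<tau> ^ Q))"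
      unfolding similar_matrix_def by (rule exI[of _ H], rule exI[of _ G]) (simp add: H)
  qed
  moreover define s where "s = (\<Sum>x\<in>C. b x * \<tau> ^ fst x * (\<tau> ^ Q) ^ snd x)"
  have V: "V = smult_matrix s (mat 1) + smult_matrix (\<tau> ^ wt x0) (H ** (B \<tau> ** G))"
  proof -
    have "H ** (smult_matrix s (mat 1) + smult_matrix z W) ** G =
        smult_matrix s (H ** G) + smult_matrix z (H ** (W ** G))" for z W
      by (simp only: matrix_add_ldistrib matrix_mult_add_left smult_matrix_mult_left
          smult_matrix_mult_right matrix_mul_rid matrix_mul_assoc)
    thus ?thesis unfolding V_def B s_def[symmetric] by (simp only: H)
  qed
  have "V $ p $ a = (if p = a then s else if p = \<sigma> a then \<tau> ^ wt x0 else 0)" if a: "a \<in> A" for a p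
  proof -
    have a': "a \<notin> \<sigma> ` A" using a A(2) unfolding disjoint_iff by metis
    hence a'': "\<sigma> a \<noteq> a" using imageI[OF a, of \<sigma>] by auto
    \<comment> \<open>By construction of \<open>G\<close>, applying \<open>B \<tau>\<close> to its
      column \<open>a\<close> gives its column \<open>\<sigma> a\<close>.\<close>
    have "(B \<tau> ** G) $ i $ a = G $ i $ \<sigma> a" for i
    proof -
      have "(B \<tau> ** G) $ i $ a = (B \<tau> *v r a) $ i"
        using a' by (simp add: matrix_matrix_mult_def matrix_vector_mult_def G_def krylov_matrix_def)
      thus ?thesis using a A(1) by (simp add: G_def krylov_matrix_def)
    qed
    hence "(H ** (B \<tau> ** G)) $ p $ a = (H ** G) $ p $ \<sigma> a"
      by (simp add: matrix_matrix_mult_def[of H])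
    thus ?thesis using a'' by (simp add: V H mat_def)
  qed
  ultimately show ?thesis using A \<tau>(1)
    by (intro bexI[of _ V] exI[of _ A] exI[of _ \<sigma>] exI[of _ s] exI[of _ "\<tau> ^ wt x0"]) simp_all
qed

end

section \<open>The nine values\<close>

theorem corollary3p20:
  fixes f :: "'a::{alg_closed_field, field_char_0} ncpoly"
    and M :: "'a^'n::finite^'n"
  assumes "CARD('n) \<ge> 2"
    and "\<not> (\<exists>g. matrix_identity TYPE('n) g \<and> cyclically_equivalent f g)"
    and "\<not> matrix_central_poly TYPE('n) f"
  shows "\<exists>(c :: nat \<Rightarrow> 'a) (B :: nat \<Rightarrow> 'a^'n^'n).
           (\<forall>i<9. B i \<in> nc_image f) \<and> M = (\<Sum>i<9. smult_matrix (c i) (B i))"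
proof -
  let ?S = "nc_image f :: ('a^'n^'n) set"
  have closed: "B \<in> ?S" if "A \<in> ?S" "similar_matrix B A" for A B
    using that by (rule nc_image_similar)
  \<comment> \<open>Hence \<open>f\<close> is not an identity; as it is not central either, some
    value lies outside the center.\<close>
  have "cyclically_equivalent f f"
    unfolding cyclically_equivalent_def by (rule exI[of _ "[]"]) simp
  with assms(2,3) obtain a0 :: "nat \<Rightarrow> 'a^'n^'n" where a0: "eval_ncpoly a0 f \<notin> matrix_center"
    unfolding matrix_central_poly_def nc_image_def by blast
  obtain \<phi> :: "'n \<Rightarrow> nat" where \<phi>: "bij_betw \<phi> UNIV {0..<CARD('n)}"
    using ex_bij_betw_finite_nat[of "UNIV :: 'n set"] by auto
  obtain \<omega> :: 'a where \<omega>: "\<And>d. \<omega> ^ d = 1 \<longleftrightarrow> CARD('n) dvd d"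
    using primitive_root_of_unity[of "CARD('n)"] by auto
  interpret clock_shift \<phi> \<omega>
    by unfold_locales (rule \<phi>, rule \<omega>)
  from noncentral_value_far_from_scalars[OF assms(1) a0] obtain b A \<sigma> s t where b: "b \<in> ?S"
    and \<sigma>: "inj_on \<sigma> A" "\<sigma> ` A \<inter> A = {}" and A: "CARD('n) \<le> 3 * card A" and t: "t \<noteq> 0"
    and ent: "\<forall>a\<in>A. \<forall>p. b $ p $ a = (if p = a then s else if p = \<sigma> a then t else 0)"
    by blast
  have "\<exists>h. inj h \<and> diag_matrix h \<in> lincombs 4 ?S"
    by (rule diag_matrix_lincombs[OF ent t \<sigma> A b]) (rule closed)
  then obtain h :: "'n \<Rightarrow> 'a" where h: "inj h" "diag_matrix h \<in> lincombs 4 ?S" by blast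
  obtain a1 :: "nat \<Rightarrow> 'a^'n^'n" where a1: "trace (eval_ncpoly a1 f) \<noteq> 0"
    using trace_zero_cyclically_equivalent_identity assms(2) by blast
  define V where "V = eval_ncpoly a1 f"
  \<comment> \<open>Chosen so that subtracting \<open>c\<close> times \<open>V\<close> from
    \<open>M\<close> leaves trace zero; eight values handle the difference and \<open>V\<close> is
    the ninth.\<close>
  define c where "c = trace M / trace V"
  have "trace (M - smult_matrix c V) = 0"
    using a1 by (simp add: trace_sub trace_smult c_def V_def)
  from h this have "M - smult_matrix c V \<in> lincombs (4 + 4) ?S"
    by (rule trace_zero_lincombs) (rule closed)
  moreover have "smult_matrix c V \<in> lincombs 1 ?S"
    by (rule lincombs_1) (simp add: V_def nc_image_def)
  ultimately have "M - smult_matrix c V + smult_matrix c V \<in> lincombs (4 + 4 + 1) ?S"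
    by (rule lincombs_add)
  hence "M \<in> lincombs 9 ?S" by simp
  thus ?thesis unfolding lincombs_def by blast
qed

end
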